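(* Let $(X,D)$ be a toric pair of dimension $d-1\ge 1$ over an algebraically closed field $K$ of characteristic $p>0$, with associated polytope $P_D\subset\mathbb{R}^{d-1}$. Let $C_D\subset \mathbb{R}^{d-1}\times\mathbb{R}=\mathbb{R}^d$ be the convex rational polyhedral cone spanned by $P_D\times\{1\}$, and let $$\mathcal{P}_D=\{p\in C_D \mid p\notin (u,1)+C_D \ \text{ for every } u\in P_D\cap\mathbb{Z}^{d-1}\}.$$ Then the Hilbert-Kunz density function of $(X,D)$ is the sectional volume function of the closure $\overline{\mathcal{P}}_D$ of $\mathcal{P}_D$: for every real $\lambda\ge 0$, $$HKd(X,D)(\lambda)=\mathrm{Vol}_{d-1}\big(\overline{\mathcal{P}}_D\cap\{z=\lambda\}\big).$$
   Context: Toric pair: Let $T$ be a torus with cocharacter lattice $N\cong\mathbb{Z}^{d-1}$ and character lattice $M=\mathrm{Hom}(N,\mathbb{Z})$, identified with $\mathbb{Z}^{d-1}$, so $M_{\mathbb{R}}=\mathbb{R}^{d-1}$. A toric pair $(X,D)$ consists of a projective toric variety $X$ of dimension $d-1\ge1$ over $K$, given by a complete fan in $N_{\mathbb{R}}$ whose rays have primitive generators $v_1,\dots,v_n$, and a very ample $T$-Cartier divisor $D=\sum_i a_iD_i$ on $X$ ($a_i\in\mathbb{Z}$, $D_i$ the $T$-invariant prime divisor corresponding to $v_i$). Its associated lattice polytope is $P_D=\{u\in M_{\mathbb{R}}\mid \langle u,v_i\rangle\ge -a_i \text{ for all } i\}$. Homogeneous coordinate ring: if $P_D\cap M=\{u_1,\dots,u_r\}$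 and $S\subset M\times\mathbb{Z}$ is the semigroup generated by $(u_1,1),\dots,(u_r,1)$, the homogeneous coordinate ring of $(X,D)$ is $R=K[S]=K[\chi^{(u_1,1)},\dots,\chi^{(u_r,1)}]$, a standard graded ring of dimension $d$ with $\deg\chi^{(u_i,1)}=1$; $\mathbf{m}$ denotes its graded maximal ideal. Hilbert-Kunz density function: $HKd(X,D):[0,\infty)\to[0,\infty)$ is $$HKd(X,D)(\lambda)=\lim_{n\to\infty}\frac{1}{q^{d-1}}\,\ell\big((R/\mathbf{m}^{[q]})_{\lfloor q\lambda\rfloor}\big),\qquad q=p^n,$$ where $\mathbf{m}^{[q]}$ is the ideal generated by $q$-th powers of elements of $\mathbf{m}$, the subscript denotes the graded component, and $\ell$ is length. (It is known that this limit exists, uniformly in $\lambda$, and is a compactly supported continuous function.) The last coordinate of $\mathbb{R}^d$ is denoted $z$; for $Q\subseteq\mathbb{R}^d$, $Q\cap\{z=\lambda\}$ is the slice of points of $Q$ with last coordinate $\lambda$, and $\mathrm{Vol}_{d-1}$ is $(d-1)$-dimensional Lebesgue volume in the hyperplane $\{z=\lambda\}\cong\mathbb{R}^{d-1}$. *)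

theory Defs
  imports
    "HOL-Analysis.Analysis"
    "HOL-Library.Poly_Mapping"
    "HOL-Library.Extended_Nat"
    "HOL-Computational_Algebra.Polynomial"
    "HOL-Algebra.Ideal"
begin

text \<open>
  Throughout, the finite type \<open>'n\<close> has \<open>d - 1\<close> elements. Both lattices \<open>N\<close> and \<open>M\<close> are
  \<open>int ^ 'n\<close>, both \<open>N\<^sub>\<real>\<close> and \<open>M\<^sub>\<real>\<close> are \<open>real ^ 'n\<close>, and the pairing is the standard inner
  product. The ground field is the type \<open>'k\<close>.
\<close>

definition rvec :: "int ^ 'n \<Rightarrow> real ^ 'n" where
  "rvec u = (\<chi> i. of_int (u $ i))"


section \<open>Fans, divisors, polytopes\<close>

definition rational_cone :: "(real ^ 'n) set \<Rightarrow> bool" where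
  "rational_cone \<sigma> \<longleftrightarrow> (\<exists>B. finite B \<and> \<sigma> = convex_cone hull (rvec ` B))"

definition strongly_convex :: "(real ^ 'n) set \<Rightarrow> bool" where
  "strongly_convex \<sigma> \<longleftrightarrow> \<sigma> \<inter> uminus ` \<sigma> = {0}"

text \<open>\<^const>\<open>face_of\<close> admits the empty set as a face; the nonempty faces of a polyhedral cone
  are its faces in the sense of toric geometry.\<close>

definition fan :: "(real ^ 'n) set set \<Rightarrow> bool" where
  "fan \<Sigma> \<longleftrightarrow> finite \<Sigma>
     \<and> (\<forall>\<sigma>\<in>\<Sigma>. rational_cone \<sigma> \<and> strongly_convex \<sigma>)
     \<and> (\<forall>\<sigma>\<in>\<Sigma>. \<forall>\<tau>. \<tau> face_of \<sigma> \<and> \<tau> \<noteq> {} \<longrightarrow> \<tau> \<in> \<Sigma>)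
     \<and> (\<forall>\<sigma>\<in>\<Sigma>. \<forall>\<tau>\<in>\<Sigma>. (\<sigma> \<inter> \<tau>) face_of \<sigma> \<and> (\<sigma> \<inter> \<tau>) face_of \<tau>)"

definition complete_fan :: "(real ^ 'n) set set \<Rightarrow> bool" where
  "complete_fan \<Sigma> \<longleftrightarrow> fan \<Sigma> \<and> \<Union>\<Sigma> = UNIV"

definition primitive :: "int ^ 'n \<Rightarrow> bool" where
  "primitive v \<longleftrightarrow> Gcd (range (($) v)) = 1"

definition ray_gens :: "(real ^ 'n) set set \<Rightarrow> (int ^ 'n) set" where
  "ray_gens \<Sigma> = {v. primitive v \<and> convex_cone hull {rvec v} \<in> \<Sigma>}"

text \<open>A \<open>T\<close>-invariant Weil divisor \<open>D = \<Sum>\<^sub>i a\<^sub>i D\<^sub>i\<close> is a function \<open>a\<close> assigning to each primitive ray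
  generator \<open>v\<^sub>i\<close> the coefficient \<open>a\<^sub>i\<close>; values of \<open>a\<close> elsewhere are never used. As \<open>div \<chi>\<^sup>m\<close> is
  \<open>\<Sum>\<^sub>i \<langle>m, v\<^sub>i\<rangle> D\<^sub>i\<close>, local Cartier data at \<open>\<sigma>\<close> is a character \<open>\<chi>\<^sup>m\<close> with \<open>D = div \<chi>\<^sup>-\<^sup>m\<close> on \<open>U\<^sub>\<sigma>\<close>.\<close>

definition cartier_datum ::
  "(real ^ 'n) set set \<Rightarrow> (int ^ 'n \<Rightarrow> int) \<Rightarrow> (real ^ 'n) set \<Rightarrow> int ^ 'n \<Rightarrow> bool" where
  "cartier_datum \<Sigma> a \<sigma> m \<longleftrightarrow>
     (\<forall>v\<in>ray_gens \<Sigma>. rvec v \<in> \<sigma> \<longrightarrow> rvec m \<bullet> rvec v = - of_int (a v))"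

definition T_Cartier :: "(real ^ 'n) set set \<Rightarrow> (int ^ 'n \<Rightarrow> int) \<Rightarrow> bool" where
  "T_Cartier \<Sigma> a \<longleftrightarrow> (\<forall>\<sigma>\<in>\<Sigma>. \<exists>m. cartier_datum \<Sigma> a \<sigma> m)"

definition div_polytope :: "(real ^ 'n) set set \<Rightarrow> (int ^ 'n \<Rightarrow> int) \<Rightarrow> (real ^ 'n) set" where
  "div_polytope \<Sigma> a = {u. \<forall>v\<in>ray_gens \<Sigma>. u \<bullet> rvec v \<ge> - of_int (a v)}"

definition lattice_pts :: "(real ^ 'n) set \<Rightarrow> (int ^ 'n) set" where
  "lattice_pts P = {u. rvec u \<in> P}"


section \<open>The toric variety of a fan over an algebraically closed field\<close>

text \<open>The variety is described by its closed points, Zariski topology and regular functions.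
  The affine chart \<open>U\<^sub>\<sigma> = Spec K[\<sigma>\<^sup>\<or> \<inter> M]\<close> has as closed points the semigroup homomorphisms
  \<open>\<sigma>\<^sup>\<or> \<inter> M \<rightarrow> (K, \<cdot>)\<close>; they are extended by \<open>0\<close> to all of \<open>M\<close>.\<close>

definition dual_lattice :: "(real ^ 'n) set \<Rightarrow> (int ^ 'n) set" where
  "dual_lattice \<sigma> = {m. \<forall>w\<in>\<sigma>. rvec m \<bullet> w \<ge> 0}"

definition semigroup_homs :: "(real ^ 'n) set \<Rightarrow> (int ^ 'n \<Rightarrow> 'k::field) set" where
  "semigroup_homs \<sigma> = {x. x 0 = 1
     \<and> (\<forall>m\<in>dual_lattice \<sigma>. \<forall>m'\<in>dual_lattice \<sigma>. x (m + m') = x m * x m')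
     \<and> (\<forall>m. m \<notin> dual_lattice \<sigma> \<longrightarrow> x m = 0)}"

text \<open>For a face \<open>\<tau>\<close> of \<open>\<sigma>\<close>, the chart \<open>U\<^sub>\<tau>\<close> is glued into \<open>U\<^sub>\<sigma>\<close> by restricting homomorphisms from
  \<open>\<tau>\<^sup>\<or> \<inter> M\<close> to \<open>\<sigma>\<^sup>\<or> \<inter> M\<close>. A point of the glued variety is represented by the pair \<open>(\<sigma>, x)\<close> where
  \<open>U\<^sub>\<sigma>\<close> is the smallest chart containing it; its incarnation in a larger chart is a
  restriction of \<open>x\<close>.\<close>

definition toric_points ::
  "(real ^ 'n) set set \<Rightarrow> ((real ^ 'n) set \<times> (int ^ 'n \<Rightarrow> 'k::field)) set" where
  "toric_points \<Sigma> = {(\<sigma>, x). \<sigma> \<in> \<Sigma> \<and> x \<in> semigroup_homs \<sigma>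
     \<and> \<not> (\<exists>\<tau>\<in>\<Sigma>. \<tau> \<subset> \<sigma> \<and> (\<exists>y\<in>semigroup_homs \<tau>. \<forall>m\<in>dual_lattice \<sigma>. y m = x m))}"

definition chart ::
  "(real ^ 'n) set set \<Rightarrow> (real ^ 'n) set \<Rightarrow> ((real ^ 'n) set \<times> (int ^ 'n \<Rightarrow> 'k::field)) set" where
  "chart \<Sigma> \<tau> = {p \<in> toric_points \<Sigma>. fst p \<subseteq> \<tau>}"

definition chart_ring :: "(real ^ 'n) set \<Rightarrow> (int ^ 'n \<Rightarrow>\<^sub>0 'k::field) set" where
  "chart_ring \<tau> = {f. Poly_Mapping.keys f \<subseteq> dual_lattice \<tau>}"

definition toric_eval ::
  "(int ^ 'n \<Rightarrow>\<^sub>0 'k::field) \<Rightarrow> (real ^ 'n) set \<times> (int ^ 'n \<Rightarrow> 'k) \<Rightarrow> 'k" where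
  "toric_eval f p = (\<Sum>m\<in>Poly_Mapping.keys f. Poly_Mapping.lookup f m * snd p m)"

definition toric_topology ::
  "(real ^ 'n) set set \<Rightarrow> ((real ^ 'n) set \<times> (int ^ 'n \<Rightarrow> 'k::field)) topology" where
  "toric_topology \<Sigma> = topology_generated_by
     {{p \<in> chart \<Sigma> \<tau>. toric_eval f p \<noteq> 0} |\<tau> f. \<tau> \<in> \<Sigma> \<and> f \<in> chart_ring \<tau>}"

definition toric_regular ::
  "(real ^ 'n) set set \<Rightarrow> ((real ^ 'n) set \<times> (int ^ 'n \<Rightarrow> 'k::field)) set
     \<Rightarrow> ((real ^ 'n) set \<times> (int ^ 'n \<Rightarrow> 'k) \<Rightarrow> 'k) \<Rightarrow> bool" where
  "toric_regular \<Sigma> W g \<longleftrightarrow> (\<forall>p\<in>W. \<exists>\<tau>\<in>\<Sigma>. \<exists>V f h.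
     openin (toric_topology \<Sigma>) V \<and> p \<in> V \<and> V \<subseteq> W \<inter> chart \<Sigma> \<tau>
     \<and> f \<in> chart_ring \<tau> \<and> h \<in> chart_ring \<tau>
     \<and> (\<forall>p'\<in>V. toric_eval h p' \<noteq> 0 \<and> g p' = toric_eval f p' / toric_eval h p'))"


section \<open>Projective space with homogeneous coordinates indexed by a set \<open>L\<close>\<close>

definition proj_point :: "('v \<Rightarrow> 'k::field) \<Rightarrow> ('v \<Rightarrow> 'k) set" where
  "proj_point y = {(\<lambda>u. c * y u) |c. c \<noteq> 0}"

definition proj_space :: "'v set \<Rightarrow> ('v \<Rightarrow> 'k::field) set set" where
  "proj_space L = {proj_point y |y. (\<exists>u. y u \<noteq> 0) \<and> (\<forall>u. u \<notin> L \<longrightarrow> y u = 0)}"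

definition homogeneous_poly :: "nat \<Rightarrow> (('v \<Rightarrow>\<^sub>0 nat) \<Rightarrow>\<^sub>0 'k::field) \<Rightarrow> bool" where
  "homogeneous_poly k F \<longleftrightarrow> (\<forall>e\<in>Poly_Mapping.keys F. (\<Sum>u\<in>Poly_Mapping.keys e. Poly_Mapping.lookup e u) = k)"

definition poly_eval :: "(('v \<Rightarrow>\<^sub>0 nat) \<Rightarrow>\<^sub>0 'k::field) \<Rightarrow> ('v \<Rightarrow> 'k) \<Rightarrow> 'k" where
  "poly_eval F y = (\<Sum>e\<in>Poly_Mapping.keys F. Poly_Mapping.lookup F e * (\<Prod>u\<in>Poly_Mapping.keys e. y u ^ Poly_Mapping.lookup e u))"

definition proj_topology :: "'v set \<Rightarrow> ('v \<Rightarrow> 'k::field) set topology" where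
  "proj_topology L = topology_generated_by
     {{z \<in> proj_space L. \<forall>y\<in>z. poly_eval F y \<noteq> 0} |F. \<exists>k. homogeneous_poly k F}"

text \<open>Regular functions on an open subset \<open>W\<close> of the closed subvariety \<open>Z\<close>.\<close>

definition proj_regular ::
  "'v set \<Rightarrow> ('v \<Rightarrow> 'k::field) set set \<Rightarrow> ('v \<Rightarrow> 'k) set set
     \<Rightarrow> (('v \<Rightarrow> 'k) set \<Rightarrow> 'k) \<Rightarrow> bool" where
  "proj_regular L Z W g \<longleftrightarrow> (\<forall>z\<in>W. \<exists>V k F G.
     openin (subtopology (proj_topology L) Z) V \<and> z \<in> V \<and> V \<subseteq> W
     \<and> homogeneous_poly k F \<and> homogeneous_poly k G
     \<and> (\<forall>z'\<in>V. \<forall>y\<in>z'. poly_eval G y \<noteq> 0 \<and> g z' = poly_eval F y / poly_eval G y))"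


section \<open>Very ample divisors and toric pairs\<close>

text \<open>The sections \<open>\<chi>\<^sup>u\<close>, \<open>u \<in> P\<^sub>D \<inter> M\<close>, form a basis of \<open>\<Gamma>(X, O(D))\<close>. On \<open>U\<^sub>\<sigma>\<close>, \<open>O(D)\<close> is trivialized by
  \<open>\<chi>\<^sup>m\<close> with \<open>m\<close> a Cartier datum at \<open>\<sigma>\<close>, so \<open>\<chi>\<^sup>u\<close> becomes the function \<open>\<chi>\<^sup>u\<^sup>-\<^sup>m\<close>. Another choice of \<open>m\<close>
  rescales all coordinates by a common unit.\<close>

definition section_coords ::
  "(real ^ 'n) set set \<Rightarrow> (int ^ 'n \<Rightarrow> int) \<Rightarrow> (real ^ 'n) set \<times> (int ^ 'n \<Rightarrow> 'k::field)
     \<Rightarrow> int ^ 'n \<Rightarrow> 'k" where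
  "section_coords \<Sigma> a p = (\<lambda>u. if u \<in> lattice_pts (div_polytope \<Sigma> a)
     then snd p (u - (SOME m. cartier_datum \<Sigma> a (fst p) m)) else 0)"

definition base_point_free :: "'k::field itself \<Rightarrow> (real ^ 'n) set set \<Rightarrow> (int ^ 'n \<Rightarrow> int) \<Rightarrow> bool" where
  "base_point_free _ \<Sigma> a \<longleftrightarrow>
     (\<forall>p \<in> (toric_points \<Sigma> :: ((real ^ 'n) set \<times> (int ^ 'n \<Rightarrow> 'k)) set).
        \<exists>u. section_coords \<Sigma> a p u \<noteq> 0)"

text \<open>A closed embedding of varieties is an isomorphism onto a Zariski closed subvariety: a
  homeomorphism onto a closed subset under which the regular functions correspond.\<close>

definition closed_embedding ::
  "(real ^ 'n) set set \<Rightarrow> 'v set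
     \<Rightarrow> ((real ^ 'n) set \<times> (int ^ 'n \<Rightarrow> 'k::field) \<Rightarrow> ('v \<Rightarrow> 'k) set) \<Rightarrow> bool" where
  "closed_embedding \<Sigma> L \<phi> \<longleftrightarrow> (let Z = \<phi> ` toric_points \<Sigma> in
     embedding_map (toric_topology \<Sigma>) (proj_topology L) \<phi>
     \<and> closedin (proj_topology L) Z
     \<and> (\<forall>W g. openin (subtopology (proj_topology L) Z) W \<longrightarrow>
          (proj_regular L Z W g
             \<longleftrightarrow> toric_regular \<Sigma> {p \<in> toric_points \<Sigma>. \<phi> p \<in> W} (g \<circ> \<phi>))))"

definition very_ample :: "'k::field itself \<Rightarrow> (real ^ 'n) set set \<Rightarrow> (int ^ 'n \<Rightarrow> int) \<Rightarrow> bool" where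
  "very_ample K \<Sigma> a \<longleftrightarrow> base_point_free K \<Sigma> a
     \<and> closed_embedding \<Sigma> (lattice_pts (div_polytope \<Sigma> a))
         (\<lambda>p :: (real ^ 'n) set \<times> (int ^ 'n \<Rightarrow> 'k). proj_point (section_coords \<Sigma> a p))"

text \<open>Projectivity of \<open>X\<close> is part of very ampleness.\<close>

definition toric_pair ::
  "'k::alg_closed_field itself \<Rightarrow> (real ^ 'n) set set \<Rightarrow> (int ^ 'n \<Rightarrow> int) \<Rightarrow> bool" where
  "toric_pair K \<Sigma> a \<longleftrightarrow> complete_fan \<Sigma> \<and> T_Cartier \<Sigma> a \<and> very_ample K \<Sigma> a"


section \<open>Homogeneous coordinate ring and Hilbert-Kunz density function\<close>

inductive_set coord_semigroup :: "(real ^ 'n) set \<Rightarrow> ((int ^ 'n) \<times> int) set"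
  for P :: "(real ^ 'n) set" where
  zero: "0 \<in> coord_semigroup P"
| add: "s \<in> coord_semigroup P \<Longrightarrow> u \<in> lattice_pts P \<Longrightarrow> s + (u, 1) \<in> coord_semigroup P"

text \<open>\<open>R = K[S]\<close> inside the group algebra \<open>K[M \<times> \<int>]\<close>.\<close>

definition coord_ring :: "(real ^ 'n) set \<Rightarrow> (((int ^ 'n) \<times> int) \<Rightarrow>\<^sub>0 'k::field) ring" where
  "coord_ring P = \<lparr>carrier = {f. Poly_Mapping.keys f \<subseteq> coord_semigroup P},
     monoid.mult = (*), one = 1, zero = 0, add = (+)\<rparr>"

definition graded_part :: "(real ^ 'n) set \<Rightarrow> int \<Rightarrow> (((int ^ 'n) \<times> int) \<Rightarrow>\<^sub>0 'k::field) set" where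
  "graded_part P i = {f \<in> carrier (coord_ring P). \<forall>s\<in>Poly_Mapping.keys f. snd s = i}"

definition max_ideal :: "(real ^ 'n) set \<Rightarrow> (((int ^ 'n) \<times> int) \<Rightarrow>\<^sub>0 'k::field) set" where
  "max_ideal P = {f \<in> carrier (coord_ring P). \<forall>s\<in>Poly_Mapping.keys f. snd s > 0}"

definition frobenius_power ::
  "(real ^ 'n) set \<Rightarrow> nat \<Rightarrow> (((int ^ 'n) \<times> int) \<Rightarrow>\<^sub>0 'k::field) set" where
  "frobenius_power P q = genideal (coord_ring P) {f ^ q |f. f \<in> max_ideal P}"

definition kscale :: "'k::field \<Rightarrow> ('m::monoid_add \<Rightarrow>\<^sub>0 'k) \<Rightarrow> ('m \<Rightarrow>\<^sub>0 'k)" where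
  "kscale c f = Poly_Mapping.single 0 c * f"

text \<open>Length of the \<open>K\<close>-module \<open>V / W\<close>; its chains of submodules are the chains of subspaces between
  \<open>W\<close> and \<open>V\<close>.\<close>

definition quotient_length ::
  "('m::monoid_add \<Rightarrow>\<^sub>0 'k::field) set \<Rightarrow> ('m \<Rightarrow>\<^sub>0 'k) set \<Rightarrow> enat" where
  "quotient_length V W = Sup {enat k |k. \<exists>U. U 0 = W \<and> U k = V
     \<and> (\<forall>i\<le>k. module.subspace kscale (U i)) \<and> (\<forall>i<k. U i \<subset> U (Suc i))}"

text \<open>Since \<open>m\<^sup>[\<^sup>q\<^sup>]\<close> is a homogeneous ideal for \<open>q\<close> a power of the characteristic,
  \<open>(R / m\<^sup>[\<^sup>q\<^sup>])\<^sub>i = R\<^sub>i / (m\<^sup>[\<^sup>q\<^sup>] \<inter> R\<^sub>i)\<close>.\<close>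

definition hk_length :: "'k::field itself \<Rightarrow> (real ^ 'n) set \<Rightarrow> nat \<Rightarrow> int \<Rightarrow> nat" where
  "hk_length _ P q i = the_enat (quotient_length (graded_part P i)
     (frobenius_power P q \<inter> graded_part P i :: (((int ^ 'n) \<times> int) \<Rightarrow>\<^sub>0 'k) set))"

definition HKd ::
  "'k::field itself \<Rightarrow> (real ^ 'n) set set \<Rightarrow> (int ^ 'n \<Rightarrow> int) \<Rightarrow> real \<Rightarrow> real" where
  "HKd K \<Sigma> a t = lim (\<lambda>n. let q = CHAR('k) ^ n in
     real (hk_length K (div_polytope \<Sigma> a) q \<lfloor>real q * t\<rfloor>) / real q ^ CARD('n))"


section \<open>The cone \<open>C\<^sub>D\<close> and the set \<open>\<P>\<^sub>D\<close>\<close>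

text \<open>\<open>\<real>\<^sup>d = \<real>\<^sup>d\<^sup>-\<^sup>1 \<times> \<real>\<close> is the product type, so \<open>z\<close> is \<^const>\<open>snd\<close>.\<close>

definition div_cone :: "(real ^ 'n) set \<Rightarrow> ((real ^ 'n) \<times> real) set" where
  "div_cone P = convex_cone hull (P \<times> {1})"

definition hk_region :: "(real ^ 'n) set \<Rightarrow> ((real ^ 'n) \<times> real) set" where
  "hk_region P = {p \<in> div_cone P.
     \<forall>u\<in>lattice_pts P. p \<notin> (\<lambda>c. (rvec u, 1) + c) ` div_cone P}"

definition section_volume :: "((real ^ 'n) \<times> real) set \<Rightarrow> real \<Rightarrow> real" where
  "section_volume Q t = measure lborel {x. (x, t) \<in> Q}"

end

theory Submission
  imports Defs
begin

text \<open>
  Frobenius is additive, so \<open>m\<^sup>[\<^sup>q\<^sup>]\<close> is spanned by the monomials \<open>s \<in> S\<close> with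
  \<open>s - q (u, 1) \<in> S\<close> for some lattice point \<open>u\<close> of \<open>P\<^sub>D\<close>, and the length counts the remaining
  monomials of degree \<open>\<lfloor>q \<lambda>\<rfloor>\<close>. Base point freeness shows that \<open>P\<^sub>D\<close> is the convex hull of its lattice
  points, and the closed embedding forces \<open>S\<close> to generate the whole lattice \<open>M \<times> \<int>\<close>; hence \<open>S\<close> contains
  a translate of \<open>C\<^sub>D \<inter> (M \<times> \<int>)\<close>. After rescaling by \<open>1/q\<close>, membership in \<open>S\<close> therefore becomes membership
  in \<open>C\<^sub>D\<close> at every point off the frontier of the cone. Written as integrals of step functions, the
  normalised counts converge by dominated convergence, because the slices of that frontier are null sets.
\<close>

section \<open>The Frobenius power as a span of monomials\<close>

text \<open>Very ampleness does not make \<open>S\<close> saturated, so lattice points of the cone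
  can be missing from \<open>S\<close>. What saves the count is that the defect is controlled by one
  fixed shift \<open>c\<close>, which shrinks to \<open>c / q\<close> after rescaling. Such a shift
  requires that differences of elements of \<open>S\<close> fill the whole lattice. Bijectivity on
  points could not give that: in characteristic p the map raising to p-th powers is bijective on a
  torus, so a sublattice of p-power index goes unnoticed by points. Hence the correspondence of
  regular functions is used, applied to single characters. \<open>div_polytope\<close> is only an
  intersection of half-spaces; boundedness and integral vertices come from one fact. Every direction
  \<open>w\<close> lies in some cone of the complete fan, and a section that does not vanish at the
  distinguished point of that cone is a lattice point of the polytope minimising \<open>w\<close>.
  Working pointwise replaces error estimates near the boundary: off the frontiers, membership of the
  rescaled grid point is eventually constant.\<close>

definition monomial_span :: "'m set \<Rightarrow> ('m \<Rightarrow>\<^sub>0 'k::field) set" where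
  "monomial_span A = {f. Poly_Mapping.keys f \<subseteq> A}"

lemma lookup_kscale: "Poly_Mapping.lookup (kscale c f) s = c * Poly_Mapping.lookup f s"
  by (simp add: kscale_def mult_map_scale_conv_mult[symmetric] Poly_Mapping.map.rep_eq when_def)

lemma vector_space_kscale: "vector_space (kscale :: 'k::field \<Rightarrow> ('m::monoid_add \<Rightarrow>\<^sub>0 'k) \<Rightarrow> _)"
  by unfold_locales (auto intro!: poly_mapping_eqI simp: lookup_kscale lookup_add algebra_simps)

lemma subspace_monomial_span:
  "module.subspace kscale (monomial_span A :: ('m::monoid_add \<Rightarrow>\<^sub>0 'k::field) set)"
proof -
  interpret vector_space "kscale :: 'k \<Rightarrow> ('m \<Rightarrow>\<^sub>0 'k) \<Rightarrow> _" by (rule vector_space_kscale)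
  show ?thesis
    unfolding subspace_def monomial_span_def
    by (auto simp: in_keys_iff lookup_kscale subset_iff lookup_add) (metis add_0)
qed

lemma sum_singles: "(\<Sum>s\<in>Poly_Mapping.keys f. Poly_Mapping.single s (Poly_Mapping.lookup f s)) = f"
  by (rule poly_mapping_eqI)
    (auto simp: lookup_sum lookup_single when_def in_keys_iff)

lemma dim_monomial_span:
  assumes "finite A"
  shows "vector_space.dim kscale (monomial_span A :: ('m::monoid_add \<Rightarrow>\<^sub>0 'k::field) set) = card A"
    and "\<exists>T. finite T \<and> (monomial_span A :: ('m::monoid_add \<Rightarrow>\<^sub>0 'k::field) set) \<subseteq> module.span kscale T"
proof -
  interpret vector_space "kscale :: 'k \<Rightarrow> ('m \<Rightarrow>\<^sub>0 'k) \<Rightarrow> _" by (rule vector_space_kscale)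
  let ?b = "\<lambda>s::'m. Poly_Mapping.single s (1::'k)"
  have inj: "inj_on ?b A" by (auto intro!: inj_onI dest!: arg_cong[where f = Poly_Mapping.keys])
  have sub: "monomial_span A \<subseteq> span (?b ` A)"
  proof
    fix f :: "'m \<Rightarrow>\<^sub>0 'k" assume f: "f \<in> monomial_span A"
    have "(\<Sum>s\<in>Poly_Mapping.keys f. kscale (Poly_Mapping.lookup f s) (?b s)) \<in> span (?b ` A)"
      using f by (intro span_sum span_scale span_base) (auto simp: monomial_span_def)
    then show "f \<in> span (?b ` A)"
      by (simp add: kscale_def mult_single sum_singles)
  qed
  have ind: "independent (?b ` A)"
  proof (rule independent_if_scalars_zero)
    show "finite (?b ` A)" using assms by simp
    fix g x assume 0: "(\<Sum>x\<in>?b ` A. kscale (g x) x) = 0" and "x \<in> ?b ` A"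
    then obtain s where s: "s \<in> A" "x = ?b s" by auto
    have "0 = Poly_Mapping.lookup (\<Sum>x\<in>?b ` A. kscale (g x) x) s" using 0 by simp
    also have "\<dots> = (\<Sum>r\<in>A. g (?b r) when r = s)"
      by (simp add: sum.reindex[OF inj] lookup_sum lookup_kscale lookup_single mult_when)
    also have "\<dots> = g x" using s assms by (simp add: when_def)
    finally show "g x = 0" by simp
  qed
  have le: "?b ` A \<subseteq> monomial_span A" by (auto simp: monomial_span_def)
  show "dim (monomial_span A :: ('m \<Rightarrow>\<^sub>0 'k) set) = card A"
    using basis_card_eq_dim[OF le sub ind] card_image[OF inj] by simp
  show "\<exists>T. finite T \<and> (monomial_span A :: ('m \<Rightarrow>\<^sub>0 'k) set) \<subseteq> span T"
    using sub assms by blast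
qed

text \<open>A basis of \<open>U\<close> together with one vector of \<open>U' - U\<close> extends to
  a basis of \<open>U'\<close>. The finite set \<open>T\<close> makes that basis finite, so that
  \<open>card\<close> really counts it; on infinite sets \<open>card\<close> is 0.\<close>

lemma (in vector_space) dim_strict_mono:
  assumes U: "subspace U" and U': "subspace U'" and lt: "U \<subset> U'" and T: "finite T" "U' \<subseteq> span T"
  shows "dim U < dim U'"
proof -
  obtain B where B: "B \<subseteq> U" "independent B" "U \<subseteq> span B" "card B = dim U"
    using basis_exists[of U] by blast
  obtain v where v: "v \<in> U'" "v \<notin> U" using lt by blast
  have spB: "span B \<subseteq> U" using B(1) U by (simp add: span_minimal)
  then have vB: "v \<notin> span B" using v by blast
  then have ind: "independent (insert v B)" using B(2) independent_insertI by blast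
  have sub: "insert v B \<subseteq> U'" using B(1) lt v by blast
  obtain B' where B': "insert v B \<subseteq> B'" "B' \<subseteq> U'" "independent B'" "U' \<subseteq> span B'"
    using maximal_independent_subset_extend[OF sub ind] by metis
  have fin: "finite B'" using independent_span_bound[of T B'] B' T by blast
  have "v \<notin> B" using vB span_base by blast
  then have "card B < card (insert v B)" using fin B' finite_subset
    by (metis card_insert_disjoint finite_insert lessI)
  also have "\<dots> \<le> card B'" using B' fin card_mono by blast
  also have "\<dots> = dim U'" using B' basis_card_eq_dim by blast
  finally show ?thesis using B by simp
qed

text \<open>Each strict inclusion raises the dimension by at least one, which bounds the number of
  steps in a chain. Adjoining the exponents of \<open>A - B\<close> one at a time gives a chain that
  attains the bound.\<close>

lemma quotient_length_monomial_span:
  assumes A: "finite A" and B: "B \<subseteq> A"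
  shows "quotient_length (monomial_span A :: ('m::monoid_add \<Rightarrow>\<^sub>0 'k::field) set) (monomial_span B)
    = enat (card (A - B))"
  unfolding quotient_length_def
proof (rule antisym[OF Sup_least Sup_upper])
  interpret vector_space "kscale :: 'k \<Rightarrow> ('m \<Rightarrow>\<^sub>0 'k) \<Rightarrow> _" by (rule vector_space_kscale)
  obtain T where T: "finite T" "(monomial_span A :: ('m \<Rightarrow>\<^sub>0 'k) set) \<subseteq> span T"
    using dim_monomial_span(2)[OF A] by blast
  have fB: "finite B" using A B finite_subset by blast
  fix x assume "x \<in> {enat k |k. \<exists>U. U 0 = (monomial_span B :: ('m \<Rightarrow>\<^sub>0 'k) set) \<and> U k = monomial_span A
    \<and> (\<forall>i\<le>k. subspace (U i)) \<and> (\<forall>i<k. U i \<subset> U (Suc i))}"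
  then obtain k U where x: "x = enat k" and U: "U 0 = (monomial_span B :: ('m \<Rightarrow>\<^sub>0 'k) set)"
    "U k = monomial_span A" "\<And>i. i \<le> k \<Longrightarrow> subspace (U i)" "\<And>i. i < k \<Longrightarrow> U i \<subset> U (Suc i)" by blast
  have mono: "U i \<subseteq> U k" if "i \<le> k" for i
    using that by (induction rule: inc_induct) (use U(4) in blast)+
  have "i \<le> k \<Longrightarrow> dim (U 0) + i \<le> dim (U i)" for i
  proof (induction i)
    case (Suc i)
    have "dim (U i) < dim (U (Suc i))"
      using dim_strict_mono[of "U i" "U (Suc i)" T] U(2-4) T mono[of "Suc i"] Suc.prems by force
    then show ?case using Suc by simp
  qed simp
  from this[of k] have "card B + k \<le> card A"
    using dim_monomial_span(1)[OF A, where 'k = 'k] dim_monomial_span(1)[OF fB, where 'k = 'k] U by simp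
  then show "x \<le> enat (card (A - B))" using x card_Diff_subset[OF fB B] by simp
next
  define k where "k = card (A - B)"
  obtain h where h: "bij_betw h {..<k} (A - B)"
    using ex_bij_betw_nat_finite[of "A - B"] A unfolding k_def atLeast0LessThan by blast
  define U where "U i = (monomial_span (B \<union> h ` {..<i}) :: ('m \<Rightarrow>\<^sub>0 'k) set)" for i
  have "U i \<subset> U (Suc i)" if "i < k" for i
  proof
    show "U i \<subseteq> U (Suc i)" by (auto simp: U_def monomial_span_def less_Suc_eq)
    have "h i \<notin> B \<union> h ` {..<i}"
      using h that inj_on_image_mem_iff[of h "{..<k}" i "{..<i}"] by (auto simp: bij_betw_def)
    then have "Poly_Mapping.single (h i) 1 \<in> U (Suc i)" "Poly_Mapping.single (h i) 1 \<notin> U i"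
      by (auto simp: U_def monomial_span_def)
    then show "U i \<noteq> U (Suc i)" by blast
  qed
  moreover have "U 0 = monomial_span B" "U k = monomial_span A"
    using h B by (auto simp: U_def bij_betw_def Un_absorb1)
  moreover have "module.subspace kscale (U i)" for i
    unfolding U_def by (rule subspace_monomial_span)
  ultimately show "enat (card (A - B)) \<in> {enat k |k. \<exists>U. U 0 = (monomial_span B :: ('m \<Rightarrow>\<^sub>0 'k) set)
    \<and> U k = monomial_span A \<and> (\<forall>i\<le>k. module.subspace kscale (U i)) \<and> (\<forall>i<k. U i \<subset> U (Suc i))}"
    unfolding k_def by blast
qed

section \<open>Arithmetic of the coordinate semigroup\<close>

lemma coord_semigroup_add:
  assumes "s \<in> coord_semigroup P" "r \<in> coord_semigroup P"
  shows "s + r \<in> coord_semigroup P"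
  using assms(2,1)
  by (induction rule: coord_semigroup.induct) (auto simp: add.assoc[symmetric] intro: coord_semigroup.intros)

lemma coord_semigroup_gen: "u \<in> lattice_pts P \<Longrightarrow> (u, 1) \<in> coord_semigroup P"
  using coord_semigroup.add[OF coord_semigroup.zero] by force

lemma coord_semigroup_snd_nonneg: "s \<in> coord_semigroup P \<Longrightarrow> snd s \<ge> 0"
  by (induction rule: coord_semigroup.induct) auto

text \<open>The exponent of the \<open>q\<close>-th power of the monomial with exponent
  \<open>s\<close>.\<close>

definition nat_mul :: "nat \<Rightarrow> (int ^ 'n) \<times> int \<Rightarrow> (int ^ 'n) \<times> int" where
  "nat_mul q s = (int q *s fst s, int q * snd s)"

lemma nat_mul_0 [simp]: "nat_mul 0 s = 0"
  by (simp add: nat_mul_def zero_prod_def)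

lemma nat_mul_Suc: "nat_mul (Suc q) s = s + nat_mul q s"
  by (cases s) (simp add: nat_mul_def algebra_simps vec_eq_iff)

lemma nat_mul_add: "nat_mul q (s + r) = nat_mul q s + nat_mul q r"
  by (induction q) (auto simp: nat_mul_Suc)

lemma coord_semigroup_nat_mul: "s \<in> coord_semigroup P \<Longrightarrow> nat_mul q s \<in> coord_semigroup P"
  by (induction q) (simp_all add: nat_mul_Suc coord_semigroup.zero coord_semigroup_add)

lemma single_power: "Poly_Mapping.single s c ^ q = Poly_Mapping.single (nat_mul q s) (c ^ q)"
  by (induction q) (auto simp: nat_mul_Suc mult_single)

lemma finite_coord_semigroup_graded:
  assumes "finite (lattice_pts P)"
  shows "finite {s \<in> coord_semigroup P. snd s = i}"
proof -
  have "finite {s \<in> coord_semigroup P. snd s = int k}" for k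
  proof (induction k)
    case 0
    have "{s \<in> coord_semigroup P. snd s = int 0} \<subseteq> {0}"
    proof safe
      fix s assume "s \<in> coord_semigroup P" and "snd s = int 0"
      then show "s = 0" by cases (use coord_semigroup_snd_nonneg in fastforce)+
    qed
    then show ?case using finite_subset by blast
  next
    case (Suc k)
    have "{s \<in> coord_semigroup P. snd s = int (Suc k)}
      \<subseteq> (\<lambda>(s, u). s + (u, 1)) ` ({s \<in> coord_semigroup P. snd s = int k} \<times> lattice_pts P)"
    proof safe
      fix s :: "(int^'a) \<times> int" assume "s \<in> coord_semigroup P" and i: "snd s = int (Suc k)"
      then show "s \<in> (\<lambda>(s, u). s + (u, 1)) ` ({s \<in> coord_semigroup P. snd s = int k} \<times> lattice_pts P)"
        by cases (auto intro!: image_eqI)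
    qed
    then show ?case using Suc assms by (meson finite_SigmaI finite_imageI finite_subset)
  qed
  from this[of "nat i"] show ?thesis
  proof (cases "i \<ge> 0")
    case False
    then have "{s \<in> coord_semigroup P. snd s = i} = {}" using coord_semigroup_snd_nonneg by fastforce
    then show ?thesis by (metis finite.emptyI)
  qed (simp del: of_nat_Suc)
qed

section \<open>The coordinate ring and the monomials of its Frobenius powers\<close>

lemma monomial_span_mult:
  "f \<in> monomial_span (coord_semigroup P) \<Longrightarrow> g \<in> monomial_span (coord_semigroup P)
    \<Longrightarrow> f * g \<in> monomial_span (coord_semigroup P)"
  using keys_mult[of f g] coord_semigroup_add[of _ P] unfolding monomial_span_def by blast

lemma coord_ring_simps [simp]:
  "carrier (coord_ring P) = monomial_span (coord_semigroup P)"
  "x \<otimes>\<^bsub>coord_ring P\<^esub> y = x * y" "x \<oplus>\<^bsub>coord_ring P\<^esub> y = x + y"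
  "\<one>\<^bsub>coord_ring P\<^esub> = 1" "\<zero>\<^bsub>coord_ring P\<^esub> = 0"
  by (simp_all add: coord_ring_def monomial_span_def)

lemma zero_one_monomial_span [simp]:
  "0 \<in> monomial_span A" "1 \<in> monomial_span (coord_semigroup P)"
  by (simp_all add: monomial_span_def coord_semigroup.zero)

lemma monomial_span_add:
  "f \<in> monomial_span A \<Longrightarrow> g \<in> monomial_span A \<Longrightarrow> f + g \<in> monomial_span A"
  using keys_add[of f g] by (auto simp: monomial_span_def)

lemma monomial_span_uminus:
  "f \<in> monomial_span A \<Longrightarrow> - f \<in> monomial_span (A :: 'm set)" for f :: "'m \<Rightarrow>\<^sub>0 'k::field"
  by (auto simp: monomial_span_def in_keys_iff)

lemma ring_coord_ring: "ring (coord_ring P :: ((int ^ 'n) \<times> int \<Rightarrow>\<^sub>0 'k::field) ring)"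
proof (rule ringI)
  show "abelian_group (coord_ring P :: ((int ^ 'n) \<times> int \<Rightarrow>\<^sub>0 'k) ring)"
  proof (rule abelian_groupI)
    fix x :: "(int ^ 'n) \<times> int \<Rightarrow>\<^sub>0 'k" assume "x \<in> carrier (coord_ring P)"
    then show "\<exists>y\<in>carrier (coord_ring P). y \<oplus>\<^bsub>coord_ring P\<^esub> x = \<zero>\<^bsub>coord_ring P\<^esub>"
      by (intro bexI[of _ "- x"]) (simp_all add: monomial_span_uminus)
  qed (simp_all add: monomial_span_add ac_simps)
  show "Group.monoid (coord_ring P :: ((int ^ 'n) \<times> int \<Rightarrow>\<^sub>0 'k) ring)"
    by (rule monoidI) (simp_all add: monomial_span_mult mult.assoc)
qed (simp_all add: algebra_simps)

definition frobenius_exps :: "(real ^ 'n) set \<Rightarrow> nat \<Rightarrow> ((int ^ 'n) \<times> int) set" where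
  "frobenius_exps P q = {s \<in> coord_semigroup P. \<exists>u\<in>lattice_pts P. s - nat_mul q (u, 1) \<in> coord_semigroup P}"

lemma frobenius_exps_add:
  assumes "s \<in> frobenius_exps P q" "r \<in> coord_semigroup P"
  shows "s + r \<in> frobenius_exps P q"
proof -
  obtain u where u: "u \<in> lattice_pts P" "s - nat_mul q (u, 1) \<in> coord_semigroup P"
    using assms by (auto simp: frobenius_exps_def)
  then have "(s - nat_mul q (u, 1)) + r \<in> coord_semigroup P" using assms coord_semigroup_add by blast
  then have "s + r - nat_mul q (u, 1) \<in> coord_semigroup P" by (simp add: algebra_simps)
  moreover have "s + r \<in> coord_semigroup P"
    using assms by (simp add: coord_semigroup_add frobenius_exps_def)
  ultimately show ?thesis using u(1) unfolding frobenius_exps_def by blast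
qed

lemma ideal_frobenius_exps:
  "ideal (monomial_span (frobenius_exps P q)) (coord_ring P :: ((int ^ 'n) \<times> int \<Rightarrow>\<^sub>0 'k::field) ring)"
proof (rule idealI[OF ring_coord_ring])
  let ?R = "coord_ring P :: ((int ^ 'n) \<times> int \<Rightarrow>\<^sub>0 'k) ring"
  let ?I = "monomial_span (frobenius_exps P q) :: ((int ^ 'n) \<times> int \<Rightarrow>\<^sub>0 'k) set"
  interpret ring ?R by (rule ring_coord_ring)
  have minus: "\<ominus>\<^bsub>?R\<^esub> x = - x" if "x \<in> monomial_span (coord_semigroup P)" for x
    using minus_equality[of "- x" x] that by (simp add: monomial_span_uminus)
  have sub: "?I \<subseteq> monomial_span (coord_semigroup P)"
    by (auto simp: monomial_span_def frobenius_exps_def)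
  show "subgroup ?I (add_monoid ?R)"
  proof (rule add.subgroupI)
    show "?I \<subseteq> carrier ?R" using sub by simp
    show "?I \<noteq> {}" using zero_one_monomial_span(1) by (metis empty_iff)
    show "\<ominus>\<^bsub>?R\<^esub> x \<in> ?I" if "x \<in> ?I" for x
      using that sub minus[of x] monomial_span_uminus[OF that] by auto
    show "x \<oplus>\<^bsub>?R\<^esub> y \<in> ?I" if "x \<in> ?I" "y \<in> ?I" for x y
      using monomial_span_add[OF that] by simp
  qed
  fix f g assume f: "f \<in> ?I" and g: "g \<in> carrier ?R"
  have "f * g \<in> ?I"
    using keys_mult[of f g] f g frobenius_exps_add[of _ P q]
    unfolding monomial_span_def coord_ring_simps by blast
  then show "g \<otimes>\<^bsub>?R\<^esub> f \<in> ?I" "f \<otimes>\<^bsub>?R\<^esub> g \<in> ?I"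
    by (simp_all add: mult.commute)
qed

text \<open>Additivity of Frobenius refers to the characteristic of the ring it acts on, here the
  group algebra; the constants \<open>single 0 c\<close> carry the characteristic over from
  \<open>'k\<close>.\<close>

lemma CHAR_poly_mapping:
  "CHAR('m::comm_monoid_add \<Rightarrow>\<^sub>0 'k::field) = CHAR('k)"
proof (rule CHAR_eqI)
  have eq: "(of_nat n :: 'm \<Rightarrow>\<^sub>0 'k) = Poly_Mapping.single 0 (of_nat n)" for n
    by (rule single_of_nat[symmetric])
  show "(of_nat CHAR('k) :: 'm \<Rightarrow>\<^sub>0 'k) = 0" unfolding eq by (simp del: single_of_nat)
  show "CHAR('k) dvd n" if "(of_nat n :: 'm \<Rightarrow>\<^sub>0 'k) = 0" for n
    using arg_cong[OF that, of "\<lambda>f. Poly_Mapping.lookup f 0"] unfolding eq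
    by (simp add: of_nat_eq_0_iff_char_dvd del: single_of_nat)
qed

text \<open>In characteristic p the \<open>q\<close>-th power acts term by term, so
  \<open>f ^ q\<close> only involves exponents \<open>nat_mul q s\<close>. Conversely, a monomial
  whose exponent has witness \<open>u\<close> is the \<open>q\<close>-th power of the generator at
  \<open>u\<close> times a monomial of the ring.\<close>

lemma frobenius_power_eq:
  assumes "prime CHAR('k::field)" and q: "q = CHAR('k) ^ n"
  shows "frobenius_power P q = (monomial_span (frobenius_exps P q) :: ((int ^ 'n) \<times> int \<Rightarrow>\<^sub>0 'k) set)"
proof
  let ?I = "monomial_span (frobenius_exps P q) :: ((int ^ 'n) \<times> int \<Rightarrow>\<^sub>0 'k) set"
  have "f ^ q \<in> ?I" if f: "f \<in> max_ideal P" for f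
  proof -
    have "f ^ q = (\<Sum>s\<in>Poly_Mapping.keys f. Poly_Mapping.single s (Poly_Mapping.lookup f s)) ^ q"
      by (simp add: sum_singles)
    also have "\<dots> = (\<Sum>s\<in>Poly_Mapping.keys f. Poly_Mapping.single (nat_mul q s) (Poly_Mapping.lookup f s ^ q))"
      by (subst freshmans_dream_sum'[where n = n]) (simp_all add: CHAR_poly_mapping assms single_power)
    finally have eq: "f ^ q = \<dots>" .
    have "nat_mul q s \<in> frobenius_exps P q" if s: "s \<in> Poly_Mapping.keys f" for s
    proof -
      \<comment> \<open>Positive degree excludes \<open>s = 0\<close>, so a last generator
        \<open>(u, 1)\<close> splits off and leaves \<open>nat_mul q r\<close> in the
        semigroup.\<close>
      have "s \<in> coord_semigroup P" "snd s > 0"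
        using s f by (auto simp: max_ideal_def monomial_span_def)
      then obtain r u where "s = r + (u, 1)" "u \<in> lattice_pts P" "r \<in> coord_semigroup P"
        by (cases rule: coord_semigroup.cases) auto
      then show ?thesis
        by (auto simp: frobenius_exps_def nat_mul_add intro!: coord_semigroup_add coord_semigroup_nat_mul
          coord_semigroup_gen bexI[of _ u])
    qed
    moreover have "Poly_Mapping.keys (f ^ q) \<subseteq> (\<Union>s\<in>Poly_Mapping.keys f. {nat_mul q s})"
      unfolding eq by (rule order_trans[OF keys_sum]) auto
    ultimately show ?thesis by (auto simp: monomial_span_def)
  qed
  then show "frobenius_power P q \<subseteq> ?I"
    unfolding frobenius_power_def genideal_def using ideal_frobenius_exps by blast
  let ?R = "coord_ring P :: ((int ^ 'n) \<times> int \<Rightarrow>\<^sub>0 'k) ring"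
  show "?I \<subseteq> frobenius_power P q"
    unfolding frobenius_power_def genideal_def
  proof safe
    fix f J assume f: "f \<in> ?I" and J: "ideal J ?R" and gen: "{f ^ q |f. f \<in> max_ideal P} \<subseteq> J"
    interpret ideal J ?R by (rule J)
    have single: "Poly_Mapping.single s c \<in> J" if s: "s \<in> frobenius_exps P q" for s c
    proof -
      obtain u where u: "u \<in> lattice_pts P" "s - nat_mul q (u, 1) \<in> coord_semigroup P"
        using s by (auto simp: frobenius_exps_def)
      have "Poly_Mapping.single (u, 1) 1 \<in> max_ideal P"
        using u by (auto simp: max_ideal_def monomial_span_def coord_semigroup_gen)
      then have "Poly_Mapping.single (u, 1) 1 ^ q \<in> J"
        using gen by blast
      then have "Poly_Mapping.single (nat_mul q (u, 1)) 1 \<in> J"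
        unfolding single_power power_one .
      moreover have "Poly_Mapping.single (s - nat_mul q (u, 1)) c \<in> carrier ?R"
        using u by (auto simp: monomial_span_def)
      ultimately show ?thesis
        using I_r_closed[of "Poly_Mapping.single (nat_mul q (u, 1)) 1" "Poly_Mapping.single (s - nat_mul q (u, 1)) c"]
        by (simp add: mult_single)
    qed
    have "(\<Sum>s\<in>K. Poly_Mapping.single s (Poly_Mapping.lookup f s)) \<in> J"
      if "finite K" "K \<subseteq> frobenius_exps P q" for K
      using that
    proof induction
      case empty
      then show ?case using additive_subgroup.zero_closed[OF is_additive_subgroup] by simp
    next
      case (insert s K)
      then show ?case
        using additive_subgroup.a_closed[OF is_additive_subgroup single[of s "Poly_Mapping.lookup f s"]]
        by simp
    qed
    from this[of "Poly_Mapping.keys f"] show "f \<in> J"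
      using f by (simp add: sum_singles monomial_span_def)
  qed
qed

lemma hk_length_eq:
  assumes "prime CHAR('k::field)" and q: "q = CHAR('k) ^ n" and fin: "finite (lattice_pts P)"
  shows "hk_length TYPE('k) P q i
    = card {s \<in> coord_semigroup P. snd s = i \<and> (\<forall>u\<in>lattice_pts P. s - nat_mul q (u, 1) \<notin> coord_semigroup P)}"
proof -
  let ?A = "{s \<in> coord_semigroup P. snd s = i}"
  have 1: "graded_part P i = (monomial_span ?A :: (_ \<Rightarrow>\<^sub>0 'k) set)"
    by (auto simp: graded_part_def monomial_span_def)
  have 2: "frobenius_power P q \<inter> graded_part P i = (monomial_span (frobenius_exps P q \<inter> ?A) :: (_ \<Rightarrow>\<^sub>0 'k) set)"
    unfolding 1 frobenius_power_eq[OF assms(1,2)] by (auto simp: monomial_span_def)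
  have "hk_length TYPE('k) P q i = card (?A - frobenius_exps P q \<inter> ?A)"
    unfolding hk_length_def 2 unfolding 1
    by (subst quotient_length_monomial_span[OF finite_coord_semigroup_graded[OF fin]]) auto
  also have "?A - frobenius_exps P q \<inter> ?A
    = {s \<in> coord_semigroup P. snd s = i \<and> (\<forall>u\<in>lattice_pts P. s - nat_mul q (u, 1) \<notin> coord_semigroup P)}"
    by (auto simp: frobenius_exps_def)
  finally show ?thesis .
qed

section \<open>The polytope of a base point free divisor\<close>

lemma rvec_add: "rvec (u + v) = rvec u + rvec v"
  and rvec_diff: "rvec (u - v) = rvec u - rvec v"
  and rvec_zero [simp]: "rvec 0 = 0"
  by (simp_all add: rvec_def vec_eq_iff)

lemma inj_rvec: "inj rvec"
  by (auto intro!: injI simp: rvec_def vec_eq_iff)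

section \<open>Finitely generated cones and their extremal rays\<close>

lemma convex_cone_sum:
  assumes "convex_cone C" "\<And>b. b \<in> B \<Longrightarrow> f b \<in> C"
  shows "sum f B \<in> C"
  using assms(2)
  by (induction B rule: infinite_finite_induct)
    (auto simp: convex_cone_contains_0[OF assms(1)] intro: convex_cone_add[OF assms(1)])

lemma convex_cone_hull_finiteE:
  assumes "finite B" "x \<in> convex_cone hull B"
  obtains c where "\<And>b. b \<in> B \<Longrightarrow> c b \<ge> 0" "x = (\<Sum>b\<in>B. c b *\<^sub>R b)"
proof -
  let ?C = "{x. \<exists>c. (\<forall>b\<in>B. c b \<ge> 0) \<and> x = (\<Sum>b\<in>B. c b *\<^sub>R b)}"
  have "convex_cone ?C"
    unfolding convex_cone_iff
  proof (intro conjI ballI allI impI)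
    show "0 \<in> ?C" by (auto intro!: exI[of _ "\<lambda>_. 0"])
    show "x + y \<in> ?C" if "x \<in> ?C" "y \<in> ?C" for x y
      using that
      apply clarsimp
      subgoal for c d
        by (rule exI[of _ "\<lambda>b. c b + d b"]) (simp add: scaleR_add_left sum.distrib)
      done
    show "k *\<^sub>R x \<in> ?C" if "x \<in> ?C" "0 \<le> k" for x k
      using that
      apply clarsimp
      subgoal for c
        by (rule exI[of _ "\<lambda>b. k * c b"]) (simp add: scaleR_sum_right)
      done
  qed
  moreover have "B \<subseteq> ?C"
  proof
    fix b assume "b \<in> B"
    moreover have "(\<Sum>b'\<in>B. (if b' = b then 1 else 0) *\<^sub>R b') = (\<Sum>b'\<in>B. if b' = b then b' else 0)"
      by (rule sum.cong) auto
    ultimately show "b \<in> ?C"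
      using assms(1) by (intro CollectI exI[of _ "\<lambda>b'. if b' = b then 1 else 0"]) auto
  qed
  ultimately have "convex_cone hull B \<subseteq> ?C" by (simp add: hull_minimal)
  then show ?thesis using that assms(2) by blast
qed

lemma convex_cone_hull_sum:
  "(\<And>b. b \<in> B \<Longrightarrow> c b \<ge> 0) \<Longrightarrow> (\<Sum>b\<in>B. c b *\<^sub>R b) \<in> convex_cone hull B"
  by (intro convex_cone_sum convex_cone_convex_cone_hull convex_cone_hull_mul) (auto simp: hull_inc)

lemma convex_cone_hull_singleton: "convex_cone hull {b} = {c *\<^sub>R b | c. c \<ge> 0}"
proof
  show "convex_cone hull {b} \<subseteq> {c *\<^sub>R b | c. c \<ge> 0}"
    using convex_cone_hull_finiteE[of "{b}"] by (smt (verit) finite.emptyI finite.insertI insertI1 mem_Collect_eq subsetI sum.empty sum.insert add.right_neutral empty_iff)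
  show "{c *\<^sub>R b | c. c \<ge> 0} \<subseteq> convex_cone hull {b}"
    by (auto intro!: convex_cone_hull_mul simp: hull_inc)
qed

text \<open>Redundant generators are dropped one at a time. Irredundancy makes each remaining
  generator span an extremal ray, by \<open>extremal_ray_face\<close>.\<close>

lemma minimal_convex_cone_generators:
  assumes "finite B"
  obtains B' where "B' \<subseteq> B" "convex_cone hull B' = convex_cone hull B"
    "\<And>b. b \<in> B' \<Longrightarrow> b \<notin> convex_cone hull (B' - {b})"
proof -
  have "\<exists>B'\<subseteq>B. convex_cone hull B' = convex_cone hull B \<and> (\<forall>b\<in>B'. b \<notin> convex_cone hull (B' - {b}))"
    using assms
  proof (induction rule: finite_psubset_induct)
    case (psubset B)
    show ?case
    proof (cases "\<forall>b\<in>B. b \<notin> convex_cone hull (B - {b})")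
      case False
      then obtain b where b: "b \<in> B" "b \<in> convex_cone hull (B - {b})" by blast
      then have "convex_cone hull (B - {b}) = convex_cone hull B"
        using hull_redundant[of b convex_cone "B - {b}"] by (simp add: insert_absorb)
      moreover have "B - {b} \<subset> B" using b by blast
      ultimately show ?thesis using psubset.IH[of "B - {b}"] by (metis order.trans psubset_imp_subset)
    qed blast
  qed
  then show ?thesis using that by blast
qed

text \<open>Expand two points of \<open>\<sigma>\<close> with sum \<open>t *\<^sub>R b\<close> in
  the generators and add: the generators other than \<open>b\<close> combine, with coefficients
  \<open>\<gamma> c \<ge> 0\<close>, to \<open>(t - \<gamma> b) *\<^sub>R b\<close>. If
  \<open>t - \<gamma> b\<close> were positive, \<open>b\<close> would be redundant. Otherwise each
  \<open>\<gamma> c *\<^sub>R c\<close> lies in \<open>\<sigma>\<close> together with its negative,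
  and strong convexity makes it zero.\<close>

lemma extremal_ray_face:
  assumes fin: "finite B" and \<sigma>: "\<sigma> = convex_cone hull B" and sc: "strongly_convex \<sigma>"
    and b: "b \<in> B" "b \<notin> convex_cone hull (B - {b})"
  shows "convex_cone hull {b} face_of \<sigma>"
proof -
  let ?T = "convex_cone hull {b}"
  have ray: "y \<in> ?T" if y: "y \<in> \<sigma>" and z: "z \<in> \<sigma>" and yz: "y + z \<in> ?T" for y z
  proof -
    obtain t where t: "t \<ge> 0" "y + z = t *\<^sub>R b" using yz unfolding convex_cone_hull_singleton by blast
    obtain \<alpha> where \<alpha>: "\<And>c. c \<in> B \<Longrightarrow> \<alpha> c \<ge> 0" "y = (\<Sum>c\<in>B. \<alpha> c *\<^sub>R c)"
      using convex_cone_hull_finiteE[OF fin] y \<sigma> by blast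
    obtain \<beta> where \<beta>: "\<And>c. c \<in> B \<Longrightarrow> \<beta> c \<ge> 0" "z = (\<Sum>c\<in>B. \<beta> c *\<^sub>R c)"
      using convex_cone_hull_finiteE[OF fin] z \<sigma> by blast
    define \<gamma> where "\<gamma> c = \<alpha> c + \<beta> c" for c
    have \<gamma>0: "\<gamma> c \<ge> 0" if "c \<in> B" for c using \<alpha> \<beta> that by (simp add: \<gamma>_def)
    have "t *\<^sub>R b = (\<Sum>c\<in>B. \<gamma> c *\<^sub>R c)"
      unfolding t(2)[symmetric] \<alpha>(2) \<beta>(2) \<gamma>_def by (simp add: scaleR_add_left sum.distrib)
    also have "\<dots> = \<gamma> b *\<^sub>R b + (\<Sum>c\<in>B - {b}. \<gamma> c *\<^sub>R c)"
      using fin b by (simp add: sum.remove)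
    finally have rest: "(\<Sum>c\<in>B - {b}. \<gamma> c *\<^sub>R c) = (t - \<gamma> b) *\<^sub>R b"
      by (simp add: algebra_simps)
    have le: "t - \<gamma> b \<le> 0"
    proof (rule ccontr)
      assume pos: "\<not> t - \<gamma> b \<le> 0"
      have "inverse (t - \<gamma> b) *\<^sub>R (\<Sum>c\<in>B - {b}. \<gamma> c *\<^sub>R c) \<in> convex_cone hull (B - {b})"
        using pos \<gamma>0 by (intro convex_cone_hull_mul convex_cone_hull_sum) auto
      then show False using rest pos b by simp
    qed
    have zero: "\<alpha> c *\<^sub>R c = 0" if c: "c \<in> B - {b}" for c
    proof -
      have "(\<Sum>c\<in>B - {b}. \<gamma> c *\<^sub>R c) = \<gamma> c *\<^sub>R c + (\<Sum>c\<in>B - {b} - {c}. \<gamma> c *\<^sub>R c)"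
        using fin c by (simp add: sum.remove)
      then have "- (\<gamma> c *\<^sub>R c) = (\<Sum>c\<in>B - {b} - {c}. \<gamma> c *\<^sub>R c) + (\<gamma> b - t) *\<^sub>R b"
        unfolding rest by (simp add: algebra_simps)
      also have "\<dots> \<in> \<sigma>"
        unfolding \<sigma> using \<gamma>0 le b fin
        by (intro convex_cone_hull_add convex_cone_sum[OF convex_cone_convex_cone_hull] convex_cone_hull_mul) (auto intro: hull_inc)
      finally have m: "- (\<gamma> c *\<^sub>R c) \<in> \<sigma>" .
      have "\<gamma> c *\<^sub>R c \<in> \<sigma>"
        unfolding \<sigma> using c \<gamma>0 by (intro convex_cone_hull_mul) (auto intro: hull_inc)
      then have "\<gamma> c *\<^sub>R c \<in> \<sigma> \<inter> uminus ` \<sigma>" using m by (auto intro!: image_eqI[of _ _ "- (\<gamma> c *\<^sub>R c)"])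
      then have "\<gamma> c *\<^sub>R c = 0" using sc unfolding strongly_convex_def by blast
      then show ?thesis using \<alpha>(1)[of c] \<beta>(1)[of c] c by (auto simp: \<gamma>_def add_nonneg_eq_0_iff)
    qed
    have "y = \<alpha> b *\<^sub>R b + (\<Sum>c\<in>B - {b}. \<alpha> c *\<^sub>R c)"
      unfolding \<alpha>(2) using fin b by (simp add: sum.remove)
    also have "\<dots> = \<alpha> b *\<^sub>R b" using zero by (simp add: sum.neutral)
    finally show ?thesis using \<alpha>(1)[OF b(1)] unfolding convex_cone_hull_singleton by blast
  qed
  have sub: "?T \<subseteq> \<sigma>" unfolding \<sigma> using b by (intro hull_mono) auto
  \<comment> \<open>As \<open>\<sigma>\<close> is a cone, the positive weights can be absorbed into
    the points, which reduces segments to plain sums.\<close>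
  have seg: "y \<in> ?T" if "y \<in> \<sigma>" "z \<in> \<sigma>" "0 < u" "0 < v" "u *\<^sub>R y + v *\<^sub>R z \<in> ?T" for y z u v
  proof -
    have "u *\<^sub>R y \<in> ?T"
    proof (rule ray)
      show "u *\<^sub>R y \<in> \<sigma>" "v *\<^sub>R z \<in> \<sigma>"
        using that unfolding \<sigma> by (simp_all add: convex_cone_hull_mul)
    qed (rule that(5))
    then show ?thesis using convex_cone_hull_mul[of "u *\<^sub>R y" "{b}" "inverse u"] that(3) by simp
  qed
  show ?thesis
    unfolding face_of_def
  proof (intro conjI ballI impI)
    fix y z x assume "y \<in> \<sigma>" "z \<in> \<sigma>" "x \<in> ?T" and "x \<in> open_segment y z"
    then obtain u where u: "0 < u" "u < 1" "x = (1 - u) *\<^sub>R y + u *\<^sub>R z" by (auto simp: in_segment)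
    show "y \<in> ?T" using seg[of y z "1 - u" u] u \<open>y \<in> \<sigma>\<close> \<open>z \<in> \<sigma>\<close> \<open>x \<in> ?T\<close> by simp
    show "z \<in> ?T" using seg[of z y u "1 - u"] u \<open>y \<in> \<sigma>\<close> \<open>z \<in> \<sigma>\<close> \<open>x \<in> ?T\<close> by (simp add: add.commute)
  qed (use sub convex_convex_cone_hull in auto)
qed

section \<open>Cones of a fan, their ray generators and distinguished points\<close>

lemma primitive_multiple:
  assumes "b \<noteq> (0 :: int ^ 'n)"
  obtains g v where "g > 0" "primitive v" "rvec b = g *\<^sub>R rvec v"
proof -
  define g where "g = Gcd (range (($) b))"
  define v where "v = (\<chi> i. b $ i div g)"
  obtain i where i: "b $ i \<noteq> 0" using assms by (auto simp: vec_eq_iff)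
  have "g \<noteq> 0" using i by (auto simp: g_def)
  then have g: "g > 0" unfolding g_def by (metis Gcd_int_greater_eq_0 order_le_less)
  have gv: "b $ i = g * v $ i" for i
    by (simp add: v_def g_def)
  have "g = Gcd ((*) g ` range (($) v))"
    unfolding image_image gv[symmetric] by (rule g_def)
  also have "\<dots> = g * Gcd (range (($) v))" using g by (simp add: Gcd_mult abs_mult)
  finally have "primitive v" using g by (simp add: primitive_def)
  moreover have "rvec b = of_int g *\<^sub>R rvec v" by (simp add: rvec_def vec_eq_iff gv)
  ultimately show ?thesis using g by (intro that[of "of_int g" v]) auto
qed

lemma fan_face: "fan \<Sigma> \<Longrightarrow> \<sigma> \<in> \<Sigma> \<Longrightarrow> \<tau> face_of \<sigma> \<Longrightarrow> \<tau> \<noteq> {} \<Longrightarrow> \<tau> \<in> \<Sigma>"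
  by (simp add: fan_def)

text \<open>\<open>cartier_datum\<close> and \<open>div_polytope\<close> only constrain ray
  generators; this extends such conditions to whole cones. Irredundant generators span faces, hence
  cones of the fan, and rescaling them to primitive vectors puts them in
  \<open>ray_gens\<close>.\<close>

lemma cone_generated_by_rays:
  assumes "fan \<Sigma>" "\<sigma> \<in> \<Sigma>"
  shows "\<sigma> \<subseteq> convex_cone hull (rvec ` {v \<in> ray_gens \<Sigma>. rvec v \<in> \<sigma>})"
proof -
  obtain B0 where B0: "finite B0" "\<sigma> = convex_cone hull (rvec ` B0)" and sc: "strongly_convex \<sigma>"
    using assms by (auto simp: fan_def rational_cone_def)
  obtain B where B: "B \<subseteq> rvec ` B0" "convex_cone hull B = \<sigma>" "\<And>b. b \<in> B \<Longrightarrow> b \<notin> convex_cone hull (B - {b})"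
    using minimal_convex_cone_generators[of "rvec ` B0"] B0 by blast
  have fin: "finite B" using B B0 finite_subset by blast
  have "B \<subseteq> convex_cone hull (rvec ` {v \<in> ray_gens \<Sigma>. rvec v \<in> \<sigma>})"
  proof
    fix b assume b: "b \<in> B"
    then obtain b0 where b0: "b = rvec b0" using B by blast
    \<comment> \<open>The zero vector would be redundant, since every convex cone hull contains
      it.\<close>
    have "b \<noteq> 0" using B(3)[OF b] convex_cone_hull_contains_0 by metis
    then have "b0 \<noteq> 0" using b0 by auto
    then obtain g v where gv: "g > 0" "primitive v" "rvec b0 = g *\<^sub>R rvec v" by (rule primitive_multiple)
    have v: "rvec v = inverse g *\<^sub>R b" using gv b0 by simp
    have "convex_cone hull {b} face_of \<sigma>"
      using extremal_ray_face[OF fin _ sc b B(3)[OF b]] B by simp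
    then have "convex_cone hull {b} \<in> \<Sigma>" by (rule fan_face[OF assms _ convex_cone_hull_nonempty])
    moreover have "convex_cone hull {b} = convex_cone hull {rvec v}"
    proof (intro antisym hull_minimal convex_cone_convex_cone_hull)
      show "{b} \<subseteq> convex_cone hull {rvec v}"
        using gv b0 by (auto intro!: convex_cone_hull_mul simp: hull_inc)
      show "{rvec v} \<subseteq> convex_cone hull {b}"
        unfolding v using gv by (auto intro!: convex_cone_hull_mul simp: hull_inc)
    qed
    ultimately have "v \<in> ray_gens \<Sigma>" using gv by (simp add: ray_gens_def)
    moreover have "rvec v \<in> \<sigma>" unfolding v B(2)[symmetric] using gv b by (intro convex_cone_hull_mul) (auto intro: hull_inc)
    ultimately show "b \<in> convex_cone hull (rvec ` {v \<in> ray_gens \<Sigma>. rvec v \<in> \<sigma>})"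
      unfolding b0 gv(3) using gv by (intro convex_cone_hull_mul) (auto intro!: hull_inc)
  qed
  then have "convex_cone hull B \<subseteq> convex_cone hull (rvec ` {v \<in> ray_gens \<Sigma>. rvec v \<in> \<sigma>})"
    by (intro hull_minimal convex_cone_convex_cone_hull)
  then show ?thesis using B(2) by simp
qed

lemma nonneg_on_cone:
  assumes "fan \<Sigma>" "\<sigma> \<in> \<Sigma>" "\<And>v. v \<in> ray_gens \<Sigma> \<Longrightarrow> rvec v \<in> \<sigma> \<Longrightarrow> x \<bullet> rvec v \<ge> 0" "w \<in> \<sigma>"
  shows "x \<bullet> w \<ge> 0"
proof -
  have "convex_cone hull (rvec ` {v \<in> ray_gens \<Sigma>. rvec v \<in> \<sigma>}) \<subseteq> {w. x \<bullet> w \<ge> 0}"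
    using assms(3) by (intro hull_minimal convex_cone_halfspace_ge) auto
  then show ?thesis using cone_generated_by_rays[OF assms(1,2)] assms(4) by blast
qed

text \<open>A point of the chart of \<open>\<sigma>\<close> is listed in \<open>toric_points\<close>
  under a smallest cone to which its homomorphism extends; finiteness of the fan provides a minimal
  one.\<close>

lemma toric_point_below:
  fixes x :: "int ^ 'n \<Rightarrow> 'k::field"
  assumes "fan \<Sigma>" "\<sigma> \<in> \<Sigma>" "x \<in> semigroup_homs \<sigma>"
  obtains \<tau> y where "(\<tau>, y) \<in> toric_points \<Sigma>" "\<tau> \<subseteq> \<sigma>" "\<And>m. m \<in> dual_lattice \<sigma> \<Longrightarrow> y m = x m"
proof -
  define A where "A = {\<tau> \<in> \<Sigma>. \<tau> \<subseteq> \<sigma> \<and> (\<exists>y\<in>semigroup_homs \<tau>. \<forall>m\<in>dual_lattice \<sigma>. y m = x m)}"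
  have "finite A" "A \<noteq> {}" using assms by (auto simp: A_def fan_def)
  then obtain \<tau> where \<tau>: "\<tau> \<in> A" "\<forall>\<tau>'\<in>A. \<tau>' \<subseteq> \<tau> \<longrightarrow> \<tau> = \<tau>'" using finite_has_minimal by metis
  then obtain y where y: "y \<in> semigroup_homs \<tau>" "\<forall>m\<in>dual_lattice \<sigma>. y m = x m" "\<tau> \<in> \<Sigma>" "\<tau> \<subseteq> \<sigma>"
    by (auto simp: A_def)
  \<comment> \<open>Dual lattices grow as cones shrink, so an extension of \<open>y\<close> to a
    still smaller cone would extend \<open>x\<close> as well.\<close>
  have dual: "dual_lattice \<sigma> \<subseteq> dual_lattice \<tau>" using y by (auto simp: dual_lattice_def)
  have "\<not> (\<exists>\<tau>'\<in>\<Sigma>. \<tau>' \<subset> \<tau> \<and> (\<exists>z\<in>semigroup_homs \<tau>'. \<forall>m\<in>dual_lattice \<tau>. z m = y m))"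
  proof (intro notI, elim bexE conjE)
    fix \<tau>' z assume *: "\<tau>' \<in> \<Sigma>" "z \<in> semigroup_homs \<tau>'" "\<tau>' \<subset> \<tau>" "\<forall>m\<in>dual_lattice \<tau>. z m = y m"
    then have "\<tau>' \<in> A" using dual y unfolding A_def by (auto intro!: bexI[of _ z])
    then show False using \<tau> * by blast
  qed
  then have "(\<tau>, y) \<in> toric_points \<Sigma>" using y by (simp add: toric_points_def)
  then show ?thesis using that y by blast
qed

text \<open>Completeness puts \<open>w\<close> in a cone \<open>\<sigma>\<close>. A Cartier datum
  \<open>m\<close> there bounds the polytope from below by \<open>rvec m \<bullet> w\<close>. A
  section \<open>u\<close> that does not vanish at the distinguished point of
  \<open>\<sigma>\<close> has \<open>u - m\<close> orthogonal to \<open>\<sigma>\<close>, so it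
  attains the bound.\<close>

lemma basepoint_section:
  assumes fan: "complete_fan \<Sigma>" and cartier: "T_Cartier \<Sigma> a" and bpf: "base_point_free TYPE('k::field) \<Sigma> a"
  obtains u where "u \<in> lattice_pts (div_polytope \<Sigma> a)" "\<And>x. x \<in> div_polytope \<Sigma> a \<Longrightarrow> rvec u \<bullet> w \<le> x \<bullet> w"
proof -
  have fan': "fan \<Sigma>" using fan by (simp add: complete_fan_def)
  obtain \<sigma> where \<sigma>: "\<sigma> \<in> \<Sigma>" "w \<in> \<sigma>" using fan unfolding complete_fan_def by blast
  \<comment> \<open>The distinguished point of the torus orbit attached to
    \<open>\<sigma>\<close>.\<close>
  define x0 :: "int ^ 'a \<Rightarrow> 'k" where "x0 m = (if \<forall>w\<in>\<sigma>. rvec m \<bullet> w = 0 then 1 else 0)" for m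
  have "x0 \<in> semigroup_homs \<sigma>"
    unfolding semigroup_homs_def
  proof (intro CollectI conjI ballI allI impI)
    show "x0 0 = 1" by (simp add: x0_def)
    show "x0 m = 0" if m: "m \<notin> dual_lattice \<sigma>" for m
    proof -
      obtain w where "w \<in> \<sigma>" "\<not> rvec m \<bullet> w \<ge> 0" using m by (auto simp: dual_lattice_def)
      then have "\<not> (\<forall>w\<in>\<sigma>. rvec m \<bullet> w = 0)" by force
      then show ?thesis by (simp add: x0_def)
    qed
    fix m m' assume "m \<in> dual_lattice \<sigma>" "m' \<in> dual_lattice \<sigma>"
    then have "(\<forall>w\<in>\<sigma>. rvec (m + m') \<bullet> w = 0) \<longleftrightarrow> (\<forall>w\<in>\<sigma>. rvec m \<bullet> w = 0) \<and> (\<forall>w\<in>\<sigma>. rvec m' \<bullet> w = 0)"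
      by (auto simp: dual_lattice_def rvec_add inner_add_left add_nonneg_eq_0_iff)
    then show "x0 (m + m') = x0 m * x0 m'" by (simp add: x0_def)
  qed
  then obtain \<tau> y where \<tau>: "(\<tau>, y) \<in> toric_points \<Sigma>" "\<tau> \<subseteq> \<sigma>" and yx: "\<And>m. m \<in> dual_lattice \<sigma> \<Longrightarrow> y m = x0 m"
    using toric_point_below[OF fan' \<sigma>(1)] by blast
  have \<tau>\<Sigma>: "\<tau> \<in> \<Sigma>" and hom: "y \<in> semigroup_homs \<tau>" using \<tau> by (auto simp: toric_points_def)
  \<comment> \<open>\<open>section_coords\<close> trivialises with the chosen datum \<open>n\<close>
    at \<open>\<tau>\<close>, whereas the minimum is read off from the datum \<open>m\<close> at
    \<open>\<sigma>\<close>. Both agree on \<open>\<tau>\<close>, so \<open>n - m\<close> gives a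
    unit there and nonvanishing carries over from \<open>u - n\<close> to
    \<open>u - m\<close>.\<close>
  define n where "n = (SOME m. cartier_datum \<Sigma> a \<tau> m)"
  have n: "cartier_datum \<Sigma> a \<tau> n" unfolding n_def using cartier \<tau>\<Sigma> by (auto simp: T_Cartier_def intro: someI_ex)
  obtain m where m: "cartier_datum \<Sigma> a \<sigma> m" using cartier \<sigma> by (auto simp: T_Cartier_def)
  obtain u where u: "section_coords \<Sigma> a (\<tau>, y) u \<noteq> 0"
    using bpf \<tau>(1) unfolding base_point_free_def by blast
  then have uL: "u \<in> lattice_pts (div_polytope \<Sigma> a)" and yu: "y (u - n) \<noteq> 0"
    by (auto simp: section_coords_def n_def split: if_splits)
  have above: "(x - rvec k) \<bullet> w \<ge> 0" if "x \<in> div_polytope \<Sigma> a" "cartier_datum \<Sigma> a \<rho> k" "\<rho> \<in> \<Sigma>" "w \<in> \<rho>" for x k \<rho> w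
    by (rule nonneg_on_cone[OF fan' that(3) _ that(4)])
      (use that(1,2) in \<open>auto simp: div_polytope_def cartier_datum_def inner_diff_left\<close>)
  have "rvec (n - m) \<bullet> rvec v = 0" "rvec (m - n) \<bullet> rvec v = 0" if "v \<in> ray_gens \<Sigma>" "rvec v \<in> \<tau>" for v
    using that m n \<tau>(2) by (auto simp: cartier_datum_def rvec_diff inner_diff_left)
  then have nm: "rvec (n - m) \<bullet> w \<ge> 0" "rvec (m - n) \<bullet> w \<ge> 0" if "w \<in> \<tau>" for w
    using nonneg_on_cone[OF fan' \<tau>\<Sigma> _ that] by simp_all
  have dn: "n - m \<in> dual_lattice \<tau>" "m - n \<in> dual_lattice \<tau>" using nm by (auto simp: dual_lattice_def)
  have un: "u - n \<in> dual_lattice \<tau>"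
    using above[OF _ n \<tau>\<Sigma>] uL by (auto simp: dual_lattice_def lattice_pts_def rvec_diff)
  have um: "u - m \<in> dual_lattice \<sigma>"
    using above[OF _ m \<sigma>(1)] uL by (auto simp: dual_lattice_def lattice_pts_def rvec_diff)
  have mult: "y (k + l) = y k * y l" if "k \<in> dual_lattice \<tau>" "l \<in> dual_lattice \<tau>" for k l
    using hom that by (auto simp: semigroup_homs_def)
  have "y (n - m) * y (m - n) = 1"
    using mult[OF dn] hom by (simp add: semigroup_homs_def)
  then have "y (n - m) \<noteq> 0" by auto
  then have "y (u - m) \<noteq> 0" using mult[OF un dn(1)] yu by simp
  then have "x0 (u - m) \<noteq> 0" using yx um by simp
  then have "rvec u \<bullet> w = rvec m \<bullet> w" using \<sigma> by (auto simp: x0_def rvec_diff inner_diff_left split: if_splits)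
  then show ?thesis using that[OF uL] above[OF _ m \<sigma>] by (simp add: inner_diff_left)
qed

section \<open>Boundedness and integrality of the polytope\<close>

lemma finite_lattice_pts:
  assumes "bounded S"
  shows "finite (lattice_pts S :: (int ^ 'n) set)"
proof -
  obtain r where r: "\<And>x. x \<in> S \<Longrightarrow> norm x \<le> r" using assms by (auto simp: bounded_iff)
  have "lattice_pts S \<subseteq> (\<lambda>f. \<chi> i. f i) ` (UNIV \<rightarrow>\<^sub>E {- \<lceil>r\<rceil>..\<lceil>r\<rceil>} :: ('n \<Rightarrow> int) set)"
  proof
    fix u :: "int ^ 'n" assume "u \<in> lattice_pts S"
    then have "norm (rvec u) \<le> r" using r by (simp add: lattice_pts_def)
    then have "\<bar>of_int (u $ i) :: real\<bar> \<le> r" for i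
      using component_le_norm_cart[of "rvec u" i] by (simp add: rvec_def)
    then have "- \<lceil>r\<rceil> \<le> u $ i \<and> u $ i \<le> \<lceil>r\<rceil>" for i
      by (smt (verit, best) le_of_int_ceiling of_int_le_iff of_int_minus)
    then show "u \<in> (\<lambda>f. \<chi> i. f i) ` (UNIV \<rightarrow>\<^sub>E {- \<lceil>r\<rceil>..\<lceil>r\<rceil>})"
      by (intro image_eqI[of _ _ "($) u"]) (auto simp: PiE_def)
  qed
  then show ?thesis by (rule finite_subset) (intro finite_imageI finite_PiE, auto)
qed

text \<open>Minima exist in all directions; those along the positive and negative coordinate axes
  already enclose the polytope in a box.\<close>

lemma bounded_div_polytope:
  assumes "complete_fan \<Sigma>" "T_Cartier \<Sigma> a" "base_point_free TYPE('k::field) \<Sigma> a"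
  shows "bounded (div_polytope \<Sigma> a)"
proof -
  have "\<exists>u. \<forall>x\<in>div_polytope \<Sigma> a. rvec u \<bullet> w \<le> x \<bullet> w" for w
    using basepoint_section[OF assms] by metis
  then obtain u where u: "\<And>w x. x \<in> div_polytope \<Sigma> a \<Longrightarrow> rvec (u w) \<bullet> w \<le> x \<bullet> w" by metis
  have "div_polytope \<Sigma> a \<subseteq> cbox (\<chi> i. rvec (u (axis i 1)) $ i) (\<chi> i. rvec (u (- axis i 1)) $ i)"
  proof
    fix x assume x: "x \<in> div_polytope \<Sigma> a"
    have "rvec (u (axis i 1)) $ i \<le> x $ i" "x $ i \<le> rvec (u (- axis i 1)) $ i" for i
      using u[OF x, of "axis i 1"] u[OF x, of "- axis i 1"] by (simp_all add: inner_axis)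
    then show "x \<in> cbox (\<chi> i. rvec (u (axis i 1)) $ i) (\<chi> i. rvec (u (- axis i 1)) $ i)"
      by (simp add: mem_box_cart)
  qed
  then show ?thesis using bounded_cbox bounded_subset by blast
qed

text \<open>A point outside the hull would be separated from it by some \<open>w\<close>, yet the
  minimum of \<open>w\<close> over the polytope is attained at a lattice point.\<close>

lemma div_polytope_eq_hull:
  assumes "complete_fan \<Sigma>" "T_Cartier \<Sigma> a" "base_point_free TYPE('k::field) \<Sigma> a"
  shows "div_polytope \<Sigma> a = convex hull (rvec ` lattice_pts (div_polytope \<Sigma> a))"
proof
  let ?P = "div_polytope \<Sigma> a" and ?H = "convex hull (rvec ` lattice_pts (div_polytope \<Sigma> a))"
  have "finite (lattice_pts ?P)" using finite_lattice_pts bounded_div_polytope[OF assms] by blast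
  then have cl: "closed ?H" by (simp add: finite_imp_compact_convex_hull compact_imp_closed)
  show "?P \<subseteq> ?H"
  proof (rule ccontr)
    assume "\<not> ?P \<subseteq> ?H"
    then obtain x where x: "x \<in> ?P" "x \<notin> ?H" by blast
    then obtain w b where wb: "w \<bullet> x < b" "\<forall>y\<in>?H. b < w \<bullet> y"
      using separating_hyperplane_closed_point[OF convex_convex_hull cl] by blast
    obtain u where "u \<in> lattice_pts ?P" "rvec u \<bullet> w \<le> x \<bullet> w"
      using basepoint_section[OF assms, of w] x by metis
    then show False using wb hull_inc[of "rvec u" "rvec ` lattice_pts ?P" convex] by (force simp: inner_commute)
  qed
  have "?P = (\<Inter>v\<in>ray_gens \<Sigma>. {u. rvec v \<bullet> u \<ge> - of_int (a v)})"
    by (auto simp: div_polytope_def inner_commute)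
  then have "convex ?P" by (simp add: convex_INT convex_halfspace_ge)
  then show "?H \<subseteq> ?P" by (intro hull_minimal) (auto simp: lattice_pts_def)
qed

section \<open>The lattice generated by the coordinate semigroup\<close>

text \<open>Over a finite field the product of all \<open>X - a\<close>, plus 1, is nonconstant and
  has no root. Infinitely many scalars are needed because Laurent polynomials are compared through
  their values.\<close>

lemma infinite_alg_closed: "infinite (UNIV :: 'k::alg_closed_field set)"
proof
  assume fin: "finite (UNIV :: 'k set)"
  define p :: "'k poly" where "p = (\<Prod>a\<in>UNIV. [:-a, 1:])"
  have "degree p = card (UNIV :: 'k set)"
    unfolding p_def by (subst degree_prod_eq_sum_degree) auto
  then have "degree (p + 1) > 0"
    using fin by (subst degree_add_eq_left) (auto simp: card_gt_0_iff)
  then obtain x where "poly (p + 1) x = 0" using alg_closed_imp_poly_has_root by blast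
  moreover have "poly p x = 0" using fin by (simp add: p_def poly_prod prod_zero_iff)
  ultimately show False by simp
qed

section \<open>Laurent polynomials and generic one-parameter subgroups\<close>

lemma poly_laurent_shift:
  fixes t :: "'k::field"
  assumes "t \<noteq> 0" "\<And>a. a \<in> A \<Longrightarrow> k a + int N \<ge> 0"
  shows "poly (\<Sum>a\<in>A. monom (c a) (nat (k a + int N))) t = t ^ N * (\<Sum>a\<in>A. c a * t powi k a)"
proof -
  have "t ^ nat (k a + int N) = t ^ N * t powi k a" if "a \<in> A" for a
    using assms(1) assms(2)[OF that] by (metis mult.commute power_int_add power_int_of_nat int_nat_eq)
  then show ?thesis by (simp add: poly_sum poly_monom sum_distrib_left algebra_simps cong: sum.cong)
qed

text \<open>Agreement at infinitely many points makes the two Laurent polynomials equal, and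
  disjoint exponents then force both to be zero. Exponents may repeat within one family, so the
  conclusion concerns values, not coefficients.\<close>

lemma laurent_disjoint_exponents:
  fixes c :: "'a \<Rightarrow> 'k::field" and d :: "'b \<Rightarrow> 'k"
  assumes fin: "finite A" "finite B" and disj: "\<And>a b. a \<in> A \<Longrightarrow> b \<in> B \<Longrightarrow> k a \<noteq> l b"
    and inf: "infinite {t. t \<noteq> 0 \<and> (\<Sum>a\<in>A. c a * t powi k a) = (\<Sum>b\<in>B. d b * t powi l b)}"
    and t: "t \<noteq> 0"
  shows "(\<Sum>a\<in>A. c a * t powi k a) = 0"
proof -
  \<comment> \<open>A shift that makes the exponents of both sides nonnegative, so that ordinary
    polynomials can be compared.\<close>
  define N where "N = nat ((\<Sum>a\<in>A. \<bar>k a\<bar>) + (\<Sum>b\<in>B. \<bar>l b\<bar>))"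
  have nn: "(\<Sum>a\<in>A. \<bar>k a\<bar>) \<ge> 0" "(\<Sum>b\<in>B. \<bar>l b\<bar>) \<ge> 0" by (simp_all add: sum_nonneg)
  have N: "int N = (\<Sum>a\<in>A. \<bar>k a\<bar>) + (\<Sum>b\<in>B. \<bar>l b\<bar>)" using nn by (simp add: N_def)
  have NA: "k a + int N \<ge> 0" if "a \<in> A" for a
  proof -
    have "\<bar>k a\<bar> \<le> (\<Sum>a\<in>A. \<bar>k a\<bar>)" using that fin by (intro member_le_sum) auto
    then show ?thesis using nn N by linarith
  qed
  have NB: "l b + int N \<ge> 0" if "b \<in> B" for b
  proof -
    have "\<bar>l b\<bar> \<le> (\<Sum>b\<in>B. \<bar>l b\<bar>)" using that fin by (intro member_le_sum) auto
    then show ?thesis using nn N by linarith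
  qed
  define p where "p = (\<Sum>a\<in>A. monom (c a) (nat (k a + int N)))"
  define q where "q = (\<Sum>b\<in>B. monom (d b) (nat (l b + int N)))"
  have p: "poly p t = t ^ N * (\<Sum>a\<in>A. c a * t powi k a)" if "t \<noteq> 0" for t
    unfolding p_def using that NA by (rule poly_laurent_shift)
  have q: "poly q t = t ^ N * (\<Sum>b\<in>B. d b * t powi l b)" if "t \<noteq> 0" for t
    unfolding q_def using that NB by (rule poly_laurent_shift)
  have "infinite {t. poly (p - q) t = 0}"
    by (rule infinite_super[OF _ inf]) (auto simp: p q)
  then have "p = q" using poly_roots_finite[of "p - q"] by auto
  have "coeff p j = 0" for j
  proof (cases "\<exists>a\<in>A. j = nat (k a + int N)")
    case True
    then obtain a where a: "a \<in> A" "j = nat (k a + int N)" by blast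
    have "j \<noteq> nat (l b + int N)" if "b \<in> B" for b
      using disj[OF a(1) that] a NA[OF a(1)] NB[OF that] by auto
    then have "coeff q j = 0" unfolding q_def coeff_sum by (intro sum.neutral) force
    then show ?thesis using \<open>p = q\<close> by simp
  next
    case False
    then have "coeff p j = (\<Sum>a\<in>A. 0)" unfolding p_def coeff_sum by (intro sum.cong) auto
    then show ?thesis by simp
  qed
  then have "p = 0" by (simp add: poly_eq_iff)
  then show ?thesis using p[OF t] t by simp
qed

text \<open>The pairing of characters with one-parameter subgroups, kept integral because it serves
  as an exponent of \<open>powi\<close>.\<close>

definition dot :: "int ^ 'n \<Rightarrow> int ^ 'n \<Rightarrow> int" where
  "dot m l = (\<Sum>i\<in>UNIV. m $ i * l $ i)"

lemma dot_add: "dot (m + m') l = dot m l + dot m' l"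
  and dot_diff: "dot (m - m') l = dot m l - dot m' l"
  and dot_smult: "dot (c *s m) l = c * dot m l"
  and dot_zero: "dot 0 l = 0"
  by (simp_all add: dot_def algebra_simps sum.distrib sum_subtractf sum_distrib_left)

lemma dot_add_right: "dot m (l + l') = dot m l + dot m l'"
  and dot_smult_right: "dot m (c *s l) = c * dot m l"
  by (simp_all add: dot_def algebra_simps sum.distrib sum_distrib_left)

lemma dot_axis: "dot m (axis i 1) = m $ i"
  by (simp add: dot_def axis_def if_distrib cong: if_cong)

lemma dot_sum: "dot (sum f A) l = (\<Sum>a\<in>A. dot (f a) l)"
  by (induction A rule: infinite_finite_induct) (auto simp: dot_add dot_zero)

text \<open>By induction: if the new vector is nonzero but orthogonal to \<open>l\<close>, tilt
  \<open>l\<close> slightly towards an axis on which that vector is nonzero. Over the integers, this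
  means adding the axis to a large multiple of \<open>l\<close>.\<close>

lemma generic_covector:
  assumes "finite D"
  obtains l where "\<And>d :: int ^ 'n. d \<in> D \<Longrightarrow> dot d l = 0 \<Longrightarrow> d = 0"
proof -
  have "\<exists>l. \<forall>d\<in>D. dot d l = 0 \<longrightarrow> d = 0"
    using assms
  proof induction
    case (insert w D)
    then obtain l where l: "\<forall>d\<in>D. dot d l = 0 \<longrightarrow> d = 0" by blast
    show ?case
    proof (cases "dot w l = 0 \<and> w \<noteq> 0")
      case True
      then obtain i where i: "w $ i \<noteq> 0" by (auto simp: vec_eq_iff)
      \<comment> \<open>\<open>c\<close> exceeds every \<open>\<bar>d $ i\<bar>\<close>, while a
        nonzero \<open>dot d l\<close> is at least 1 in absolute value, so \<open>d $ i\<close>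
        cannot cancel \<open>c * dot d l\<close>.\<close>
      define c where "c = 1 + (\<Sum>d\<in>D. \<bar>d $ i\<bar>)"
      define l' where "l' = c *s l + axis i 1"
      have dot: "dot d l' = c * dot d l + d $ i" for d
        by (simp add: l'_def dot_add_right dot_smult_right dot_axis)
      have "d = 0" if d: "d \<in> D" "dot d l' = 0" for d
      proof (rule ccontr)
        assume "d \<noteq> 0"
        then have "\<bar>dot d l\<bar> \<ge> 1" using l d by force
        then have "c * 1 \<le> c * \<bar>dot d l\<bar>"
          by (intro mult_left_mono) (auto simp: c_def sum_nonneg add_nonneg_nonneg)
        also have "\<dots> = \<bar>c * dot d l\<bar>"
          by (simp add: abs_mult c_def sum_nonneg add_nonneg_nonneg)
        also have "\<dots> = \<bar>d $ i\<bar>" using d dot[of d] by linarith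
        also have "\<dots> < c" using member_le_sum[of d D "\<lambda>d. \<bar>d $ i\<bar>"] insert.hyps d by (simp add: c_def)
        finally show False by simp
      qed
      moreover have "dot w l' \<noteq> 0" using True i dot[of w] by simp
      ultimately show ?thesis by auto
    qed (use l in blast)
  qed simp
  then show ?thesis using that by blast
qed

text \<open>Strong convexity makes the apex a face of every cone. Its chart is the torus, on which
  all characters are regular.\<close>

lemma zero_cone_in_fan:
  assumes "complete_fan \<Sigma>"
  shows "{0} \<in> \<Sigma>"
proof -
  have fan: "fan \<Sigma>" using assms by (simp add: complete_fan_def)
  obtain \<sigma> where \<sigma>: "\<sigma> \<in> \<Sigma>" using assms unfolding complete_fan_def by blast
  then obtain B where B: "\<sigma> = convex_cone hull (rvec ` B)" and sc: "strongly_convex \<sigma>"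
    using fan by (auto simp: fan_def rational_cone_def)
  have z: "y = 0" if yz: "y \<in> \<sigma>" "z \<in> \<sigma>" "0 < u" "0 < v" "u *\<^sub>R y + v *\<^sub>R z = 0" for y z u v
  proof -
    have "u *\<^sub>R y \<in> \<sigma>" "v *\<^sub>R z \<in> \<sigma>" using yz B convex_cone_hull_mul by (metis order_less_imp_le)+
    moreover have "u *\<^sub>R y = - (v *\<^sub>R z)" using yz(5) by (simp add: eq_neg_iff_add_eq_0)
    ultimately have "u *\<^sub>R y \<in> \<sigma> \<inter> uminus ` \<sigma>" by blast
    then have "u *\<^sub>R y = 0" using sc unfolding strongly_convex_def by blast
    then show ?thesis using yz by simp
  qed
  have "{0} face_of \<sigma>"
    unfolding face_of_def
  proof (intro conjI ballI impI)
    show "{0} \<subseteq> \<sigma>" using B convex_cone_hull_contains_0 by auto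
    fix y z x assume yz: "y \<in> \<sigma>" "z \<in> \<sigma>" and "x \<in> {0 :: real ^ 'a}" "x \<in> open_segment y z"
    then obtain u where u: "0 < u" "u < 1" "(1 - u) *\<^sub>R y + u *\<^sub>R z = 0" by (auto simp: in_segment)
    show "y \<in> {0}" using z[of y z "1 - u" u] u yz by simp
    show "z \<in> {0}" using z[of z y u "1 - u"] u yz by (simp add: add.commute)
  qed simp
  then show ?thesis by (rule fan_face[OF fan \<sigma>]) simp
qed

section \<open>One-parameter subgroups as curves in the toric variety\<close>

definition cochar_point :: "int ^ 'n \<Rightarrow> 'k::field \<Rightarrow> (real ^ 'n) set \<times> (int ^ 'n \<Rightarrow> 'k)" where
  "cochar_point l t = ({0}, \<lambda>m. t powi dot m l)"

lemma dual_lattice_zero: "dual_lattice {0} = UNIV"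
  by (simp add: dual_lattice_def)

lemma cochar_point_in_toric_points:
  assumes "complete_fan \<Sigma>" "t \<noteq> 0"
  shows "cochar_point l t \<in> toric_points \<Sigma>"
proof -
  \<comment> \<open>The only proper subset of \<open>{0}\<close> is empty and cones are not, which
    settles the minimality condition in \<open>toric_points\<close>.\<close>
  have "{} \<notin> \<Sigma>"
    using assms(1) unfolding complete_fan_def fan_def rational_cone_def by (metis convex_cone_hull_nonempty)
  then have "\<not> \<tau> \<subset> {0}" if "\<tau> \<in> \<Sigma>" for \<tau> using that by (metis subset_singletonD psubset_eq)
  moreover have "(\<lambda>m. t powi dot m l) \<in> semigroup_homs {0}"
    using assms(2) by (simp add: semigroup_homs_def dual_lattice_zero dot_add dot_zero power_int_add)
  ultimately show ?thesis
    using zero_cone_in_fan[OF assms(1)] unfolding toric_points_def cochar_point_def by blast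
qed

lemma toric_eval_single [simp]: "toric_eval (Poly_Mapping.single m 1) p = snd p m"
  by (simp add: toric_eval_def)

lemma toric_eval_one: "p \<in> toric_points \<Sigma> \<Longrightarrow> toric_eval 1 p = 1"
  by (auto simp: toric_eval_def toric_points_def semigroup_homs_def)

lemma one_in_chart_ring: "1 \<in> chart_ring \<tau>"
  by (simp add: chart_ring_def dual_lattice_def)

lemma openin_chart:
  assumes "\<tau> \<in> \<Sigma>"
  shows "openin (toric_topology \<Sigma>) (chart \<Sigma> \<tau> :: ((real ^ 'n) set \<times> (int ^ 'n \<Rightarrow> 'k::field)) set)"
proof -
  have "(chart \<Sigma> \<tau> :: ((real ^ 'n) set \<times> (int ^ 'n \<Rightarrow> 'k::field)) set) = {p \<in> chart \<Sigma> \<tau>. toric_eval 1 p \<noteq> 0}"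
    by (auto simp: chart_def toric_eval_one)
  then show ?thesis
    unfolding toric_topology_def using assms one_in_chart_ring
    by (intro topology_generated_by_Basis) blast
qed

lemma topspace_toric_topology: "topspace (toric_topology \<Sigma>) = toric_points \<Sigma>"
proof
  show "topspace (toric_topology \<Sigma>) \<subseteq> toric_points \<Sigma>"
    by (auto simp: toric_topology_def chart_def)
  show "toric_points \<Sigma> \<subseteq> topspace (toric_topology \<Sigma>)"
  proof
    fix p assume p: "p \<in> toric_points \<Sigma>"
    then have "fst p \<in> \<Sigma>" "p \<in> chart \<Sigma> (fst p)" by (auto simp: toric_points_def chart_def)
    then show "p \<in> topspace (toric_topology \<Sigma>)"
      using openin_subset[OF openin_chart] by blast
  qed
qed

text \<open>For a basic open set, the parameters to avoid are the zeros of a Laurent polynomial that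
  is nonzero at 1. Having the identity in \<open>U\<close> lets the property pass to unions: a
  single member containing it suffices.\<close>

lemma cochar_point_cofinite:
  fixes U :: "((real ^ 'n) set \<times> (int ^ 'n \<Rightarrow> 'k::field)) set"
  assumes fan: "complete_fan \<Sigma>" and U: "openin (toric_topology \<Sigma>) U" and 1: "cochar_point l 1 \<in> U"
  shows "finite {t. t \<noteq> 0 \<and> cochar_point l t \<notin> U}"
proof -
  have "cochar_point l 1 \<in> U \<longrightarrow> finite {t. t \<noteq> 0 \<and> cochar_point l t \<notin> U}"
    using U unfolding toric_topology_def openin_topology_generated_by_iff
  proof induction
    case (Int a b)
    have "{t. t \<noteq> 0 \<and> cochar_point l t \<notin> a \<inter> b}
        = {t. t \<noteq> 0 \<and> cochar_point l t \<notin> a} \<union> {t. t \<noteq> 0 \<and> cochar_point l t \<notin> b}" by blast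
    then show ?case using Int.IH by auto
  next
    case (UN K)
    show ?case
    proof
      assume "cochar_point l 1 \<in> \<Union> K"
      then obtain k where k: "k \<in> K" "cochar_point l 1 \<in> k" by blast
      then have "finite {t. t \<noteq> 0 \<and> cochar_point l t \<notin> k}" using UN.IH by blast
      then show "finite {t. t \<noteq> 0 \<and> cochar_point l t \<notin> \<Union> K}"
        by (rule rev_finite_subset) (use k in blast)
    qed
  next
    case (Basis s)
    then obtain \<tau> f where \<tau>: "\<tau> \<in> \<Sigma>" and s: "s = {p \<in> chart \<Sigma> \<tau>. toric_eval f p \<noteq> 0}" by blast
    let ?K = "Poly_Mapping.keys f"
    have eval: "toric_eval f (cochar_point l t) = (\<Sum>m\<in>?K. Poly_Mapping.lookup f m * t powi dot m l)" for t
      by (simp add: toric_eval_def cochar_point_def)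
    show ?case
    proof
      assume s1: "cochar_point l 1 \<in> s"
      have "cochar_point l t \<in> chart \<Sigma> \<tau>" if "t \<noteq> 0" for t
        using s1 cochar_point_in_toric_points[OF fan that, of l] by (simp add: s chart_def cochar_point_def)
      \<comment> \<open>Zero is written as an empty sum so that
        \<open>laurent_disjoint_exponents\<close> applies with no exponents on the right.\<close>
      then have "{t. t \<noteq> 0 \<and> cochar_point l t \<notin> s}
          \<subseteq> {t. t \<noteq> 0 \<and> (\<Sum>m\<in>?K. Poly_Mapping.lookup f m * t powi dot m l) = (\<Sum>b\<in>({}::unit set). 0 * t powi 0)}"
        by (auto simp: s eval)
      moreover have "finite \<dots>"
      proof (rule ccontr)
        assume "infinite {t. t \<noteq> 0 \<and> (\<Sum>m\<in>?K. Poly_Mapping.lookup f m * t powi dot m l) = (\<Sum>b\<in>({}::unit set). 0 * t powi 0)}"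
        then have "(\<Sum>m\<in>?K. Poly_Mapping.lookup f m * 1 powi dot m l) = 0"
          by (intro laurent_disjoint_exponents[of _ "{} :: unit set" _ "\<lambda>_. 0" _ "\<lambda>_. 0"]) auto
        then show False using s1 eval[of 1] by (simp add: s)
      qed
      ultimately show "finite {t. t \<noteq> 0 \<and> cochar_point l t \<notin> s}" using finite_subset by blast
    qed
  qed simp
  then show ?thesis using 1 by blast
qed

text \<open>The exponent of the character to which the monomial \<open>e\<close> in the homogeneous
  coordinates pulls back, before the twist by a Cartier datum.\<close>

definition exp_sum :: "(int ^ 'n \<Rightarrow>\<^sub>0 nat) \<Rightarrow> int ^ 'n" where
  "exp_sum e = (\<Sum>u\<in>Poly_Mapping.keys e. int (Poly_Mapping.lookup e u) *s u)"

lemma exp_sum_in_coord_semigroup: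
  assumes "Poly_Mapping.keys e \<subseteq> lattice_pts P"
  shows "(exp_sum e, int (\<Sum>u\<in>Poly_Mapping.keys e. Poly_Mapping.lookup e u)) \<in> coord_semigroup P"
proof -
  have "(\<Sum>u\<in>K. nat_mul (Poly_Mapping.lookup e u) (u, 1)) \<in> coord_semigroup P" if "K \<subseteq> lattice_pts P" for K
    using that
    by (induction K rule: infinite_finite_induct)
      (auto intro!: coord_semigroup.zero coord_semigroup_add coord_semigroup_nat_mul coord_semigroup_gen)
  moreover have "(\<Sum>u\<in>K. nat_mul (Poly_Mapping.lookup e u) (u, 1))
      = (\<Sum>u\<in>K. int (Poly_Mapping.lookup e u) *s u, int (\<Sum>u\<in>K. Poly_Mapping.lookup e u))" for K
    by (simp add: nat_mul_def sum_prod)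
  ultimately show ?thesis using assms by (simp add: exp_sum_def)
qed

text \<open>Homogeneity makes the twist by \<open>m0\<close> contribute one common factor, which
  later cancels in \<open>F / G\<close>. The variables range over all of \<open>M\<close>, so
  monomials using a coordinate outside \<open>L\<close> vanish and drop out of the sum.\<close>

lemma poly_eval_torus:
  fixes F :: "(int ^ 'n \<Rightarrow>\<^sub>0 nat) \<Rightarrow>\<^sub>0 'k::field"
  assumes hom: "homogeneous_poly k F" and t: "t \<noteq> 0"
    and y: "\<And>u. y u = (if u \<in> L then t powi dot (u - m0) l else 0)"
  shows "poly_eval F y = t powi (- int k * dot m0 l) *
    (\<Sum>e | e \<in> Poly_Mapping.keys F \<and> Poly_Mapping.keys e \<subseteq> L. Poly_Mapping.lookup F e * t powi dot (exp_sum e) l)"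
proof -
  have power: "(t powi i) ^ j = t powi (int j * i)" for i j
    by (induction j) (use t in \<open>auto simp: power_int_add algebra_simps\<close>)
  have mono: "(\<Prod>u\<in>Poly_Mapping.keys e. y u ^ Poly_Mapping.lookup e u)
      = (if Poly_Mapping.keys e \<subseteq> L then t powi (- int k * dot m0 l) * t powi dot (exp_sum e) l else 0)"
    if e: "e \<in> Poly_Mapping.keys F" for e
  proof (cases "Poly_Mapping.keys e \<subseteq> L")
    case True
    let ?d = "\<lambda>u. int (Poly_Mapping.lookup e u) * dot (u - m0) l"
    have prod: "(\<Prod>u\<in>A. t powi f u) = t powi (\<Sum>u\<in>A. f u)" for A :: "(int ^ 'n) set" and f
      by (induction A rule: infinite_finite_induct) (use t in \<open>auto simp: power_int_add\<close>)
    have k: "(\<Sum>u\<in>Poly_Mapping.keys e. int (Poly_Mapping.lookup e u)) = int k"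
      using hom e by (auto simp: homogeneous_poly_def)
    have "(\<Prod>u\<in>Poly_Mapping.keys e. y u ^ Poly_Mapping.lookup e u) = (\<Prod>u\<in>Poly_Mapping.keys e. t powi ?d u)"
      using True by (intro prod.cong) (auto simp: y power)
    also have "\<dots> = t powi (\<Sum>u\<in>Poly_Mapping.keys e. ?d u)" by (rule prod)
    also have "(\<Sum>u\<in>Poly_Mapping.keys e. ?d u) = dot (exp_sum e) l - int k * dot m0 l"
      unfolding k[symmetric]
      by (simp add: exp_sum_def dot_sum dot_smult dot_diff algebra_simps sum_subtractf sum_distrib_left)
    finally show ?thesis using True t by (simp add: power_int_add[symmetric])
  next
    case False
    then obtain u where "u \<in> Poly_Mapping.keys e" "u \<notin> L" by blast
    then have "\<exists>u\<in>Poly_Mapping.keys e. y u ^ Poly_Mapping.lookup e u = 0"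
      by (intro bexI[of _ u]) (auto simp: y in_keys_iff)
    then show ?thesis using False by (simp add: prod_zero)
  qed
  have "poly_eval F y = (\<Sum>e\<in>Poly_Mapping.keys F. if Poly_Mapping.keys e \<subseteq> L
      then Poly_Mapping.lookup F e * (t powi (- int k * dot m0 l) * t powi dot (exp_sum e) l) else 0)"
    unfolding poly_eval_def by (intro sum.cong refl) (simp add: mono)
  also have "\<dots> = (\<Sum>e | e \<in> Poly_Mapping.keys F \<and> Poly_Mapping.keys e \<subseteq> L.
      Poly_Mapping.lookup F e * (t powi (- int k * dot m0 l) * t powi dot (exp_sum e) l))"
    by (rule sum.inter_filter[symmetric]) simp
  finally show ?thesis by (simp add: sum_distrib_left mult_ac)
qed

lemma proj_point_self: "y \<in> proj_point y"
  unfolding proj_point_def by (intro CollectI exI[of _ 1]) simp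

text \<open>The character \<open>\<chi>\<^sup>m\<close> is regular on the torus, so it is locally a quotient \<open>F / G\<close> of forms in the
  coordinates \<open>\<chi>\<^sup>u\<close>; comparing exponents along a generic one-parameter subgroup writes \<open>m\<close> as a
  difference of exponents of \<open>F\<close> and \<open>G\<close>.\<close>

lemma coord_semigroup_generates:
  fixes \<Sigma> :: "(real ^ 'n) set set" and m :: "int ^ 'n"
  assumes "toric_pair TYPE('k::alg_closed_field) \<Sigma> a"
  obtains s s' where "s \<in> coord_semigroup (div_polytope \<Sigma> a)" "s' \<in> coord_semigroup (div_polytope \<Sigma> a)"
    "(m, 0) = s - s'"
proof -
  define L where "L = lattice_pts (div_polytope \<Sigma> a)"
  define \<phi> where "\<phi> = (\<lambda>p :: (real ^ 'n) set \<times> (int ^ 'n \<Rightarrow> 'k). proj_point (section_coords \<Sigma> a p))"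
  define X where "X = (toric_points \<Sigma> :: ((real ^ 'n) set \<times> (int ^ 'n \<Rightarrow> 'k)) set)"
  define T where "T = (chart \<Sigma> {0} :: ((real ^ 'n) set \<times> (int ^ 'n \<Rightarrow> 'k)) set)"
  define Y where "Y = subtopology (proj_topology L) (\<phi> ` X)"
  have fan: "complete_fan \<Sigma>" using assms by (simp add: toric_pair_def)
  have emb: "closed_embedding \<Sigma> L \<phi>"
    using assms by (simp add: toric_pair_def very_ample_def L_def \<phi>_def)
  then have homeo: "homeomorphic_map (toric_topology \<Sigma>) Y \<phi>"
    by (simp add: closed_embedding_def Let_def embedding_map_def topspace_toric_topology Y_def X_def)
  have regular: "proj_regular L (\<phi> ` X) W g \<longleftrightarrow> toric_regular \<Sigma> {p \<in> X. \<phi> p \<in> W} (g \<circ> \<phi>)"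
    if "openin Y W" for W g
    using emb that by (simp add: closed_embedding_def Let_def Y_def X_def)
  have inj: "inj_on \<phi> X"
    using homeomorphic_imp_injective_map[OF homeo] by (simp add: topspace_toric_topology X_def)
  have T_open: "openin (toric_topology \<Sigma>) T"
    unfolding T_def by (rule openin_chart[OF zero_cone_in_fan[OF fan]])
  have TX: "T \<subseteq> X" by (auto simp: T_def X_def chart_def)
  define W where "W = \<phi> ` T"
  have W: "openin Y W"
    unfolding W_def using homeomorphic_map_openness[OF homeo, of T] TX T_open
    by (simp add: topspace_toric_topology X_def)
  have WT: "{p \<in> X. \<phi> p \<in> W} = T" using inj TX by (auto simp: W_def inj_on_def)
  define g where "g = (\<lambda>z. snd (inv_into X \<phi> z) m)"
  have g: "g (\<phi> p) = snd p m" if "p \<in> X" for p using inj that by (simp add: g_def)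
  have "toric_regular \<Sigma> T (g \<circ> \<phi>)"
    unfolding toric_regular_def
  proof
    fix p assume p: "p \<in> T"
    have "Poly_Mapping.single m 1 \<in> chart_ring {0}"
      by (simp add: chart_ring_def dual_lattice_zero)
    moreover have "\<forall>p'\<in>T. toric_eval 1 p' \<noteq> 0 \<and> (g \<circ> \<phi>) p' = toric_eval (Poly_Mapping.single m 1) p' / toric_eval 1 p'"
      using TX g by (auto simp: toric_eval_one X_def)
    ultimately show "\<exists>\<tau>\<in>\<Sigma>. \<exists>V f h. openin (toric_topology \<Sigma>) V \<and> p \<in> V \<and> V \<subseteq> T \<inter> chart \<Sigma> \<tau>
        \<and> f \<in> chart_ring \<tau> \<and> h \<in> chart_ring \<tau> \<and> (\<forall>p'\<in>V. toric_eval h p' \<noteq> 0 \<and> (g \<circ> \<phi>) p' = toric_eval f p' / toric_eval h p')"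
      using zero_cone_in_fan[OF fan] T_open p one_in_chart_ring
      by (intro bexI[of _ "{0}"] exI[of _ T] exI[of _ "Poly_Mapping.single m 1"] exI[of _ 1]) (auto simp: T_def)
  qed
  then have preg: "proj_regular L (\<phi> ` X) W g" using regular[OF W] WT by simp
  \<comment> \<open>The identity of the torus lies on every one-parameter subgroup. Hence
    \<open>F\<close> and \<open>G\<close> can be fixed near it before \<open>l\<close> is chosen
    generic for their exponents.\<close>
  define p1 where "p1 = (cochar_point 0 1 :: (real ^ 'n) set \<times> (int ^ 'n \<Rightarrow> 'k))"
  have p1: "cochar_point l 1 = p1" for l by (simp add: cochar_point_def p1_def)
  have curve_T: "cochar_point l t \<in> T" if "t \<noteq> 0" for l t
    using cochar_point_in_toric_points[OF fan that, of l] by (simp add: T_def chart_def cochar_point_def)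
  have "\<phi> p1 \<in> W"
    unfolding W_def p1_def using curve_T by simp
  then obtain V k F G where V: "openin Y V" "\<phi> p1 \<in> V" "V \<subseteq> W"
    and F: "homogeneous_poly k F" and G: "homogeneous_poly k G"
    and FG: "\<And>z y. z \<in> V \<Longrightarrow> y \<in> z \<Longrightarrow> poly_eval G y \<noteq> 0 \<and> g z = poly_eval F y / poly_eval G y"
    using bspec[OF preg[unfolded proj_regular_def Y_def[symmetric]] \<open>\<phi> p1 \<in> W\<close>] by metis
  define U where "U = {p \<in> X. \<phi> p \<in> V}"
  have U: "openin (toric_topology \<Sigma>) U"
    unfolding U_def X_def topspace_toric_topology[symmetric]
    by (rule openin_continuous_map_preimage[OF homeomorphic_imp_continuous_map[OF homeo] V(1)])
  define E where "E H = {e \<in> Poly_Mapping.keys H. Poly_Mapping.keys e \<subseteq> L}" for H :: "(int ^ 'n \<Rightarrow>\<^sub>0 nat) \<Rightarrow>\<^sub>0 'k"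
  have finE: "finite (E H)" for H by (simp add: E_def)
  have "finite ((\<lambda>(e, e'). m + exp_sum e - exp_sum e') ` (E G \<times> E F))" using finE by blast
  then obtain l where l: "\<And>d. d \<in> (\<lambda>(e, e'). m + exp_sum e - exp_sum e') ` (E G \<times> E F) \<Longrightarrow> dot d l = 0 \<Longrightarrow> d = 0"
    by (rule generic_covector) blast
  define m0 where "m0 = (SOME m. cartier_datum \<Sigma> a {0} m)"
  define \<Sigma>G where "\<Sigma>G t = (\<Sum>e\<in>E G. Poly_Mapping.lookup G e * t powi dot (m + exp_sum e) l)" for t
  define \<Sigma>F where "\<Sigma>F t = (\<Sum>e\<in>E F. Poly_Mapping.lookup F e * t powi dot (exp_sum e) l)" for t
  have key: "\<Sigma>G t = \<Sigma>F t \<and> \<Sigma>G t \<noteq> 0" if t: "t \<noteq> 0" and tU: "cochar_point l t \<in> U" for t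
  proof -
    define y where "y = section_coords \<Sigma> a (cochar_point l t :: (real ^ 'n) set \<times> (int ^ 'n \<Rightarrow> 'k))"
    have y: "y u = (if u \<in> L then t powi dot (u - m0) l else 0)" for u
      by (simp add: y_def section_coords_def cochar_point_def L_def m0_def)
    have "y \<in> \<phi> (cochar_point l t)" by (simp add: \<phi>_def y_def proj_point_self)
    then have ne: "poly_eval G y \<noteq> 0" and eq: "g (\<phi> (cochar_point l t)) = poly_eval F y / poly_eval G y"
      using FG tU by (auto simp: U_def)
    have "t powi dot m l * poly_eval G y = poly_eval F y"
      using eq ne g tU by (simp add: U_def cochar_point_def field_simps)
    moreover have "poly_eval F y = t powi (- int k * dot m0 l) * \<Sigma>F t"
      unfolding \<Sigma>F_def E_def by (rule poly_eval_torus[OF F t y])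
    moreover have "t powi dot m l * poly_eval G y = t powi (- int k * dot m0 l) * \<Sigma>G t"
      unfolding \<Sigma>G_def E_def poly_eval_torus[OF G t y] using t
      by (simp add: sum_distrib_left dot_add power_int_add mult_ac)
    ultimately show ?thesis using t ne by auto
  qed
  have "finite {t. t \<noteq> 0 \<and> cochar_point l t \<notin> U}"
    using cochar_point_cofinite[OF fan U, of l] V p1 TX curve_T[of 1 l] by (auto simp: U_def)
  then have fin: "finite ({0} \<union> {t. t \<noteq> 0 \<and> cochar_point l t \<notin> U})" by simp
  have "infinite (UNIV - ({0} \<union> {t. t \<noteq> 0 \<and> cochar_point l t \<notin> U}))"
    using Diff_infinite_finite[OF fin infinite_alg_closed] .
  moreover have "UNIV - ({0} \<union> {t. t \<noteq> 0 \<and> cochar_point l t \<notin> U}) \<subseteq> {t. t \<noteq> 0 \<and> \<Sigma>G t = \<Sigma>F t}"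
    using key by auto
  ultimately have inf: "infinite {t. t \<noteq> 0 \<and> \<Sigma>G t = \<Sigma>F t}" using infinite_super by blast
  \<comment> \<open>Without a common exponent both sides would vanish identically, but
    \<open>G\<close> does not vanish at the identity.\<close>
  have "\<exists>e\<in>E G. \<exists>e'\<in>E F. dot (m + exp_sum e) l = dot (exp_sum e') l"
  proof (rule ccontr)
    assume "\<not> ?thesis"
    then have "\<Sigma>G 1 = 0"
      unfolding \<Sigma>G_def
      by (intro laurent_disjoint_exponents[OF finE finE _ inf[unfolded \<Sigma>G_def \<Sigma>F_def]]) auto
    moreover have "cochar_point l 1 \<in> U" using V p1 TX curve_T[of 1 l] by (auto simp: U_def)
    ultimately show False using key[of 1] by simp
  qed
  then obtain e e' where e: "e \<in> E G" "e' \<in> E F" "dot (m + exp_sum e - exp_sum e') l = 0"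
    by (auto simp: dot_diff)
  then have "m + exp_sum e - exp_sum e' = 0" using l by force
  then have m: "m = exp_sum e' - exp_sum e" by (simp add: algebra_simps)
  \<comment> \<open>\<open>F\<close> and \<open>G\<close> have the same degree \<open>k\<close>, so
    the last coordinates cancel in the difference.\<close>
  have S: "(exp_sum e, int k) \<in> coord_semigroup (div_polytope \<Sigma> a)"
    if "e \<in> E H" "homogeneous_poly k H" for e H
    using exp_sum_in_coord_semigroup[of e "div_polytope \<Sigma> a"] that by (auto simp: E_def L_def homogeneous_poly_def)
  show ?thesis
    using that[OF S[OF e(2) F] S[OF e(1) G]] m by simp
qed

section \<open>Rescaling the semigroup to the cone\<close>

definition real_pt :: "(int ^ 'n) \<times> int \<Rightarrow> (real ^ 'n) \<times> real" where
  "real_pt s = (rvec (fst s), of_int (snd s))"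

lemma real_pt_add: "real_pt (s + r) = real_pt s + real_pt r"
  and real_pt_diff: "real_pt (s - r) = real_pt s - real_pt r"
  and real_pt_zero [simp]: "real_pt 0 = 0"
  by (simp_all add: real_pt_def rvec_add rvec_diff zero_prod_def)

lemma real_pt_nat_mul: "real_pt (nat_mul q s) = real q *\<^sub>R real_pt s"
  by (induction q) (auto simp: nat_mul_Suc real_pt_add algebra_simps)

lemma real_pt_sum: "real_pt (sum f A) = (\<Sum>a\<in>A. real_pt (f a))"
  by (induction A rule: infinite_finite_induct) (auto simp: real_pt_add)

text \<open>All that the asymptotic count uses of a toric pair; fan, field and embedding no longer
  occur. Degree-zero differences suffice because a generator supplies degree 1.\<close>

locale generating_polytope =
  fixes P :: "(real ^ 'n) set"
  assumes finite_lattice: "finite (lattice_pts P)"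
    and lattice_nonempty: "lattice_pts P \<noteq> {}"
    and hull_lattice: "P = convex hull (rvec ` lattice_pts P)"
    and degree_zero_difference:
      "\<exists>s\<in>coord_semigroup P. \<exists>s'\<in>coord_semigroup P. (m, 0) = s - s'"
begin

abbreviation "L \<equiv> lattice_pts P"
abbreviation "S \<equiv> coord_semigroup P"
abbreviation "C \<equiv> div_cone P"

lemma convex_P: "convex P"
  by (subst hull_lattice) (rule convex_convex_hull)

lemma compact_P: "compact P"
  by (subst hull_lattice) (use finite_lattice in \<open>simp add: finite_imp_compact_convex_hull\<close>)

lemma P_nonempty: "P \<noteq> {}"
  using lattice_nonempty by (auto simp: lattice_pts_def)

lemma cone_eq_lattice_hull: "C = convex_cone hull ((\<lambda>u. real_pt (u, 1)) ` L)"
proof -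
  have "P \<times> {1 :: real} = convex hull (rvec ` L \<times> {1})"
    by (subst hull_lattice) (simp add: convex_hull_Times)
  also have "rvec ` L \<times> {1} = (\<lambda>u. real_pt (u, 1)) ` L" by (auto simp: real_pt_def)
  finally show ?thesis unfolding div_cone_def
    by (metis convex_cone_convex_cone_hull convex_cone_hull_separate convex_convex_hull hull_hull hull_same)
qed

lemma closed_C: "closed C"
  unfolding cone_eq_lattice_hull using finite_lattice by (intro closed_convex_cone_hull) simp

lemma convex_cone_C: "convex_cone C"
  by (simp add: div_cone_def convex_cone_convex_cone_hull)

lemma mem_C_iff: "p \<in> C \<longleftrightarrow> (\<exists>x\<in>P. snd p \<ge> 0 \<and> fst p = snd p *\<^sub>R x)"
proof -
  have "C = (\<Union>x\<in>P \<times> {1}. \<Union>c\<in>{0..}. {c *\<^sub>R x})"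
    unfolding div_cone_def using P_nonempty convex_P
    by (subst convex_cone_hull_convex_hull_nonempty) (auto simp: hull_same convex_Times)
  then show ?thesis by (cases p) auto
qed

lemma real_pt_S: "s \<in> S \<Longrightarrow> real_pt s \<in> C"
proof (induction rule: coord_semigroup.induct)
  case (add s u)
  have "real_pt (u, 1) \<in> C" unfolding cone_eq_lattice_hull using add by (intro hull_inc) auto
  then show ?case using add convex_cone_add[OF convex_cone_C] by (simp add: real_pt_add)
qed (simp add: convex_cone_contains_0 convex_cone_C)

text \<open>A generator \<open>(u, 1)\<close> and the degree-zero difference \<open>(- u, 0)\<close>
  add up to \<open>(0, 1)\<close>, whose multiples reach every degree.\<close>

lemma group_generated: "\<exists>s\<in>S. \<exists>s'\<in>S. r = s - s'"
proof -
  define G where "G = {s - s' |s s'. s \<in> S \<and> s' \<in> S}"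
  have add: "x + y \<in> G" if xy: "x \<in> G" "y \<in> G" for x y
  proof -
    obtain a b c d where "x = a - b" "y = c - d" "a \<in> S" "b \<in> S" "c \<in> S" "d \<in> S"
      using xy unfolding G_def mem_Collect_eq by blast
    then have "x + y = (a + c) - (b + d)" "a + c \<in> S" "b + d \<in> S" by (auto simp: coord_semigroup_add)
    then show ?thesis unfolding G_def by blast
  qed
  have neg: "- x \<in> G" if x: "x \<in> G" for x
  proof -
    obtain a b where "x = a - b" "a \<in> S" "b \<in> S" using x unfolding G_def mem_Collect_eq by blast
    then have "- x = b - a" "b \<in> S" "a \<in> S" by auto
    then show ?thesis unfolding G_def by blast
  qed
  have zero: "(m, 0) \<in> G" for m
    using degree_zero_difference[of m] unfolding G_def by blast
  obtain u where u: "u \<in> L" using lattice_nonempty by blast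
  have "(u, 1) \<in> G"
    unfolding G_def using coord_semigroup_gen[OF u] coord_semigroup.zero[of P]
    by (intro CollectI exI[of _ "(u, 1)"] exI[of _ 0]) auto
  then have "(u, 1) + (- u, 0) \<in> G" using zero add by blast
  then have one: "(0, 1) \<in> G" by simp
  have nat: "(0, int k) \<in> G" for k
  proof (induction k)
    case (Suc k)
    then show ?case using add[OF one Suc] by simp
  qed (use zero in simp)
  have "(0, i) \<in> G" for i
  proof (cases "i \<ge> 0")
    case True
    then show ?thesis using nat[of "nat i"] by simp
  next
    case False
    then have "(0 :: int ^ 'n, i) = - (0, int (nat (- i)))" by simp
    then show ?thesis using neg nat by metis
  qed
  then have "(fst r, 0) + (0, snd r) \<in> G" using zero add by blast
  then have "r \<in> G" by simp
  then show ?thesis unfolding G_def by blast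
qed

text \<open>Every cone point is a nonnegative combination of the generators; the integral parts lie in
  \<open>S\<close>, and the fractional parts leave only finitely many lattice points.\<close>

lemma conductor: "\<exists>c. \<forall>s. real_pt s \<in> C \<longrightarrow> c + s \<in> S"
proof -
  \<comment> \<open>\<open>R\<close> and \<open>card L\<close> bound the combinations of generators
    with coefficients in \<open>[0, 1]\<close>, that is, the remainders after integral parts are
    split off.\<close>
  define R where "R = (\<Sum>u\<in>L. norm (rvec u))"
  define F :: "((int ^ 'n) \<times> int) set" where "F = {f. norm (rvec (fst f)) \<le> R \<and> \<bar>snd f\<bar> \<le> int (card L)}"
  have "F \<subseteq> lattice_pts (cball 0 R) \<times> {- int (card L)..int (card L)}"
    by (auto simp: F_def lattice_pts_def)
  then have finF: "finite F" using finite_lattice_pts[OF bounded_cball] finite_subset by blast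
  have "\<forall>f. \<exists>s'. s' \<in> S \<and> f + s' \<in> S"
    using group_generated by (metis diff_add_cancel)
  then obtain d where d: "\<And>f. d f \<in> S" "\<And>f. f + d f \<in> S" by metis
  have S_sum: "sum g A \<in> S" if "\<And>x. x \<in> A \<Longrightarrow> g x \<in> S" for g and A :: "'b set"
    using that by (induction A rule: infinite_finite_induct) (auto intro: coord_semigroup.zero coord_semigroup_add)
  \<comment> \<open>Adding up all shifts gives one \<open>c\<close> for every remainder:
    \<open>c + f\<close> is \<open>f + d f\<close> plus shifts that already lie in
    \<open>S\<close>.\<close>
  define c where "c = (\<Sum>f\<in>F. d f)"
  have cF: "c + f \<in> S" if "f \<in> F" for f
  proof -
    have eq: "c + f = (\<Sum>f\<in>F - {f}. d f) + (f + d f)"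
      unfolding c_def using finF that by (simp add: sum.remove[of F f] algebra_simps)
    have "(\<Sum>f\<in>F - {f}. d f) \<in> S" by (rule S_sum) (rule d(1))
    then show ?thesis unfolding eq by (rule coord_semigroup_add) (rule d(2))
  qed
  have "c + s \<in> S" if s: "real_pt s \<in> C" for s
  proof -
    have inj: "inj_on (\<lambda>u. real_pt (u, 1)) L"
      using inj_rvec by (auto simp: inj_on_def real_pt_def)
    obtain r where r: "\<And>x. x \<in> (\<lambda>u. real_pt (u, 1)) ` L \<Longrightarrow> r x \<ge> 0"
      "real_pt s = (\<Sum>x\<in>(\<lambda>u. real_pt (u, 1)) ` L. r x *\<^sub>R x)"
      using convex_cone_hull_finiteE[OF finite_imageI[OF finite_lattice] s[unfolded cone_eq_lattice_hull]] by blast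
    define r' where "r' u = r (real_pt (u, 1))" for u
    have r': "r' u \<ge> 0" if "u \<in> L" for u unfolding r'_def by (rule r(1)[OF imageI[OF that]])
    have eq: "real_pt s = (\<Sum>u\<in>L. r' u *\<^sub>R real_pt (u, 1))"
      unfolding r(2) r'_def using sum.reindex[OF inj] by simp
    define k where "k = (\<Sum>u\<in>L. nat_mul (nat \<lfloor>r' u\<rfloor>) (u, 1))"
    define e where "e u = r' u - real (nat \<lfloor>r' u\<rfloor>)" for u
    have e: "0 \<le> e u" "e u \<le> 1" if "u \<in> L" for u
    proof -
      have "e u = frac (r' u)" using r'[OF that] by (simp add: e_def frac_def)
      then show "0 \<le> e u" "e u \<le> 1" by (simp_all add: less_imp_le[OF frac_lt_1])
    qed
    have kS: "k \<in> S" unfolding k_def by (intro S_sum coord_semigroup_nat_mul coord_semigroup_gen)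
    have diff: "real_pt (s - k) = (\<Sum>u\<in>L. e u *\<^sub>R real_pt (u, 1))"
      by (simp add: real_pt_diff eq k_def real_pt_sum real_pt_nat_mul e_def scaleR_diff_left sum_subtractf)
    have "rvec (fst (s - k)) = (\<Sum>u\<in>L. e u *\<^sub>R rvec u)"
      using arg_cong[OF diff, of fst] unfolding fst_sum by (simp add: real_pt_def)
    then have "norm (rvec (fst (s - k))) \<le> (\<Sum>u\<in>L. norm (e u *\<^sub>R rvec u))" by (simp only: norm_sum)
    also have "\<dots> \<le> R" unfolding R_def using e by (intro sum_mono) (simp add: mult_left_le_one_le)
    finally have 1: "norm (rvec (fst (s - k))) \<le> R" .
    have "real_of_int (snd (s - k)) = (\<Sum>u\<in>L. e u)"
      using arg_cong[OF diff, of snd] unfolding snd_sum by (simp add: real_pt_def)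
    moreover have "0 \<le> (\<Sum>u\<in>L. e u)" by (rule sum_nonneg) (rule e)
    moreover have "(\<Sum>u\<in>L. e u) \<le> (\<Sum>u\<in>L. 1)" by (rule sum_mono) (rule e)
    ultimately have "0 \<le> real_of_int (snd (s - k))" "real_of_int (snd (s - k)) \<le> real_of_int (int (card L))"
      by simp_all
    then have "0 \<le> snd (s - k)" "snd (s - k) \<le> int (card L)" by linarith+
    then have "s - k \<in> F" using 1 by (simp add: F_def)
    then have "(c + (s - k)) + k \<in> S" using cF kS coord_semigroup_add by blast
    then show ?thesis by simp
  qed
  then show ?thesis by blast
qed

text \<open>At height \<open>t > 0\<close> an interior point of the scaled polytope is interior to
  the cone, so the slice lies in the frontier of a convex set, which is null.\<close>

lemma negligible_frontier_slice: "negligible {x. (x, t) \<in> frontier C}"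
proof (cases "t > 0")
  case True
  let ?Q = "(*\<^sub>R) t ` P"
  have "{x. (x, t) \<in> frontier C} \<subseteq> frontier ?Q"
  proof clarify
    fix x assume x: "(x, t) \<in> frontier C"
    then have "(x, t) \<in> C" using closed_C frontier_subset_closed by blast
    then have xQ: "x \<in> ?Q" by (auto simp: mem_C_iff)
    have "x \<notin> interior ?Q"
    proof
      assume "x \<in> interior ?Q"
      then have "x \<in> (*\<^sub>R) t ` interior P"
        using True by (subst interior_injective_linear_image[symmetric]) (auto intro!: injI)
      then have xt: "inverse t *\<^sub>R x \<in> interior P" using True by auto
      \<comment> \<open>The open cone over the interior of \<open>P\<close>.\<close>
      define U where "U = {p :: (real ^ 'n) \<times> real. snd p > 0} \<inter> (\<lambda>p. inverse (snd p) *\<^sub>R fst p) -` interior P"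
      have "continuous_on {p :: (real ^ 'n) \<times> real. snd p > 0} (\<lambda>p. inverse (snd p) *\<^sub>R fst p)"
        by (intro continuous_intros) auto
      then have "open U"
        unfolding U_def by (intro continuous_open_preimage open_Collect_less continuous_intros) auto
      moreover have "U \<subseteq> C"
      proof
        fix p assume "p \<in> U"
        then show "p \<in> C" unfolding mem_C_iff U_def using interior_subset[of P]
          by (intro bexI[of _ "inverse (snd p) *\<^sub>R fst p"]) auto
      qed
      moreover have "(x, t) \<in> U" using True xt by (simp add: U_def)
      ultimately have "(x, t) \<in> interior C" using interiorI by blast
      then show False using x by (simp add: frontier_def)
    qed
    then show "x \<in> frontier ?Q" using xQ closure_subset[of ?Q] unfolding frontier_def by blast
  qed
  then show ?thesis using negligible_convex_frontier[OF convex_scaling[OF convex_P]] negligible_subset by blast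
next
  case False
  \<comment> \<open>Heights \<open>t \<le> 0\<close> occur because translates by
    \<open>(u, 1)\<close> are sliced at \<open>t - 1\<close>. Only the origin can remain, a null set
    in dimension at least 1.\<close>
  have "{x. (x, t) \<in> frontier C} \<subseteq> {0}"
    using False closed_C frontier_subset_closed[of C] by (auto simp: mem_C_iff dest!: subsetD)
  then show ?thesis using negligible_sing negligible_subset by blast
qed

lemma eventually_not_S:
  assumes "((\<lambda>n. inverse (q n) *\<^sub>R real_pt (s n)) \<longlongrightarrow> z) sequentially" "z \<notin> C" "\<And>n. q n > 0"
  shows "eventually (\<lambda>n. s n \<notin> S) sequentially"
proof -
  have "eventually (\<lambda>n. inverse (q n) *\<^sub>R real_pt (s n) \<in> - C) sequentially"
    using assms closed_C by (intro topological_tendstoD) auto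
  then show ?thesis
  proof eventually_elim
    case (elim n)
    have "inverse (q n) \<ge> 0" using assms(3)[of n] by simp
    then show ?case using elim real_pt_S convex_cone_scaleR[OF convex_cone_C] by blast
  qed
qed

text \<open>Replacing \<open>s n\<close> by \<open>s n - c\<close> moves the rescaled point by a
  multiple of \<open>c\<close> tending to 0, so it still ends up in the interior of
  \<open>C\<close>; then \<open>conductor\<close> puts \<open>s n\<close> into
  \<open>S\<close>.\<close>

lemma eventually_S:
  assumes lim: "((\<lambda>n. inverse (q n) *\<^sub>R real_pt (s n)) \<longlongrightarrow> z) sequentially"
    and z: "z \<in> interior C" and q: "\<And>n. q n > 0" "filterlim q at_top sequentially"
  shows "eventually (\<lambda>n. s n \<in> S) sequentially"
proof -
  obtain c where c: "\<And>s. real_pt s \<in> C \<Longrightarrow> c + s \<in> S" using conductor by blast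
  have "((\<lambda>n. inverse (q n) *\<^sub>R real_pt (s n) - inverse (q n) *\<^sub>R real_pt c) \<longlongrightarrow> z - 0 *\<^sub>R real_pt c) sequentially"
    by (intro tendsto_diff lim tendsto_scaleR tendsto_const tendsto_inverse_0_at_top q)
  then have "eventually (\<lambda>n. inverse (q n) *\<^sub>R real_pt (s n) - inverse (q n) *\<^sub>R real_pt c \<in> interior C) sequentially"
    using z by (intro topological_tendstoD) auto
  then show ?thesis
  proof eventually_elim
    case (elim n)
    then have "inverse (q n) *\<^sub>R real_pt (s n - c) \<in> C"
      using interior_subset by (auto simp: real_pt_diff scaleR_diff_right)
    then have "q n *\<^sub>R inverse (q n) *\<^sub>R real_pt (s n - c) \<in> C"
      using q(1) convex_cone_scaleR[OF convex_cone_C] less_imp_le by blast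
    moreover have "q n \<noteq> 0" using q(1)[of n] by simp
    ultimately have "real_pt (s n - c) \<in> C" by simp
    then show ?case using c by fastforce
  qed
qed

lemma hk_region_iff: "z \<in> hk_region P \<longleftrightarrow> z \<in> C \<and> (\<forall>u\<in>L. z - real_pt (u, 1) \<notin> C)"
proof -
  have "z \<in> (+) (rvec u, 1) ` C \<longleftrightarrow> z - real_pt (u, 1) \<in> C" for u
    by (auto simp: real_pt_def intro!: image_eqI[of _ _ "z - (rvec u, 1)"])
  then show ?thesis by (simp add: hk_region_def)
qed

text \<open>An interior point of a translate \<open>(u, 1) + C\<close> has a neighbourhood disjoint
  from the region. So taking the closure can only add points on frontiers of translates.\<close>

lemma closure_hk_region_iff:
  assumes "\<And>u. u \<in> L \<Longrightarrow> z - real_pt (u, 1) \<notin> frontier C"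
  shows "z \<in> closure (hk_region P) \<longleftrightarrow> z \<in> hk_region P"
proof
  assume z: "z \<in> closure (hk_region P)"
  have "hk_region P \<subseteq> C" by (auto simp: hk_region_def)
  then have zC: "z \<in> C" using z closed_C closure_minimal by blast
  show "z \<in> hk_region P"
  proof (rule ccontr)
    assume "z \<notin> hk_region P"
    then obtain u where u: "u \<in> L" "z - real_pt (u, 1) \<in> C" using zC hk_region_iff by blast
    then have "z - real_pt (u, 1) \<in> interior C" using assms closed_C by (simp add: frontier_def)
    then have "z \<in> (+) (real_pt (u, 1)) ` interior C"
      by (intro image_eqI[of _ _ "z - real_pt (u, 1)"]) auto
    moreover have "open ((+) (real_pt (u, 1)) ` interior C)" by (simp add: open_translation)
    ultimately have "(+) (real_pt (u, 1)) ` interior C \<inter> hk_region P \<noteq> {}"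
      using z open_Int_closure_eq_empty by blast
    moreover have "real_pt (u, 1) + y \<notin> hk_region P" if "y \<in> interior C" for y
      using u that interior_subset[of C] unfolding hk_region_iff by force
    ultimately show False by blast
  qed
qed (use closure_subset in blast)

end

section \<open>Counting grid points\<close>

text \<open>The label of the half-open cube of side \<open>1 / q\<close> containing
  \<open>x\<close>.\<close>

definition grid_floor :: "real \<Rightarrow> real ^ 'n \<Rightarrow> int ^ 'n" where
  "grid_floor q x = (\<chi> j. \<lfloor>q * x $ j\<rfloor>)"

lemma grid_cell:
  fixes m :: "int ^ 'n"
  assumes q: "q > 0"
  shows "{x. grid_floor q x = m} \<in> fmeasurable lborel"
    and "measure lborel {x. grid_floor q x = m} = 1 / q ^ CARD('n)"
proof -
  define a :: "real ^ 'n" where "a = (\<chi> j. of_int (m $ j) / q)"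
  define b :: "real ^ 'n" where "b = (\<chi> j. (of_int (m $ j) + 1) / q)"
  have cell: "{x. grid_floor q x = m} = {x. \<forall>j. a $ j \<le> x $ j \<and> x $ j < b $ j}"
    using q by (auto simp: grid_floor_def vec_eq_iff floor_eq_iff a_def b_def field_simps)
  also have "\<dots> = (\<Inter>j\<in>UNIV. {x. x $ j \<ge> a $ j} \<inter> {x. x $ j < b $ j})" by auto
  also have "\<dots> \<in> sets lborel"
    by (intro sets.finite_INT sets.Int)
      (simp_all add: borel_closed closed_halfspace_component_ge_cart borel_open open_halfspace_component_lt_cart)
  finally have sets: "{x. grid_floor q x = m} \<in> sets lborel" .
  \<comment> \<open>The half-open cell is squeezed between an open and a closed box of the same
    volume.\<close>
  have box: "box a b \<subseteq> {x. grid_floor q x = m}" and cbox: "{x. grid_floor q x = m} \<subseteq> cbox a b"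
    unfolding cell by (auto simp: mem_box_cart less_imp_le)
  show fm: "{x. grid_floor q x = m} \<in> fmeasurable lborel"
    by (rule fmeasurableI2[OF fmeasurable_cbox cbox sets])
  have ab: "a $ j \<le> b $ j" for j using q by (simp add: a_def b_def divide_right_mono)
  have "measure lborel (cbox a b) = (\<Prod>j\<in>UNIV. b $ j - a $ j)"
    using ab by (intro content_cbox_cart) (auto simp: interval_ne_empty_cart)
  also have "\<dots> = 1 / q ^ CARD('n)"
    by (simp add: a_def b_def diff_divide_distrib[symmetric] power_one_over)
  finally have "measure lborel (cbox a b) = 1 / q ^ CARD('n)" .
  moreover have "measure lborel (box a b) = measure lborel (cbox a b)"
    unfolding measure_lborel_box_eq measure_lborel_cbox_eq ..
  moreover have "measure lborel (box a b) \<le> measure lborel {x. grid_floor q x = m}"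
    using box fm by (intro measure_mono_fmeasurable) auto
  moreover have "measure lborel {x. grid_floor q x = m} \<le> measure lborel (cbox a b)"
    using cbox sets by (intro measure_mono_fmeasurable) auto
  ultimately show "measure lborel {x. grid_floor q x = m} = 1 / q ^ CARD('n)" by simp
qed

text \<open>Makes a normalised lattice count an exact volume, so that convergence of counts is
  convergence of integrals of indicators.\<close>

lemma grid_count:
  fixes Q :: "(int ^ 'n) set"
  assumes q: "q > 0" and fin: "finite Q"
  shows "{x. grid_floor q x \<in> Q} \<in> fmeasurable lborel"
    and "measure lborel {x. grid_floor q x \<in> Q} = real (card Q) / q ^ CARD('n)"
proof -
  have eq: "{x. grid_floor q x \<in> Q} = (\<Union>m\<in>Q. {x. grid_floor q x = m})" by blast
  show "{x. grid_floor q x \<in> Q} \<in> fmeasurable lborel"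
    unfolding eq using fin grid_cell(1)[OF q] by (intro fmeasurable.finite_UN) auto
  have "measure lborel (\<Union>m\<in>Q. {x. grid_floor q x = m}) = (\<Sum>m\<in>Q. measure lborel {x. grid_floor q x = m})"
    using fin grid_cell(1)[OF q] by (intro measure_UNION') (auto simp: pairwise_def disjnt_def)
  then show "measure lborel {x. grid_floor q x \<in> Q} = real (card Q) / q ^ CARD('n)"
    unfolding eq by (simp add: grid_cell(2)[OF q])
qed

lemma tendsto_floor_div:
  fixes q :: "nat \<Rightarrow> real"
  assumes q: "\<And>n. q n > 0" "filterlim q at_top sequentially"
  shows "(\<lambda>n. of_int \<lfloor>q n * a\<rfloor> / q n) \<longlonglongrightarrow> a"
proof (rule tendsto_sandwich[OF _ _ _ tendsto_const])
  have "(\<lambda>n. a - inverse (q n)) \<longlonglongrightarrow> a - 0"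
    by (intro tendsto_diff tendsto_const tendsto_inverse_0_at_top q(2))
  then show "(\<lambda>n. a - inverse (q n)) \<longlonglongrightarrow> a" by simp
  show "\<forall>\<^sub>F n in sequentially. of_int \<lfloor>q n * a\<rfloor> / q n \<le> a"
    using q(1) by (auto intro!: always_eventually simp: field_simps)
  show "\<forall>\<^sub>F n in sequentially. a - inverse (q n) \<le> of_int \<lfloor>q n * a\<rfloor> / q n"
  proof (intro always_eventually allI)
    fix n
    have "q n * a - 1 \<le> of_int \<lfloor>q n * a\<rfloor>" by linarith
    then have "(q n * a - 1) / q n \<le> of_int \<lfloor>q n * a\<rfloor> / q n"
      using q(1)[of n] by (intro divide_right_mono) auto
    then show "a - inverse (q n) \<le> of_int \<lfloor>q n * a\<rfloor> / q n"
      using q(1)[of n] by (simp add: diff_divide_distrib inverse_eq_divide)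
  qed
qed

context generating_polytope
begin

lemma card_tendsto_section_volume:
  fixes q :: "nat \<Rightarrow> nat"
  assumes t: "t \<ge> 0" and q: "\<And>n. q n > 0" "filterlim q at_top sequentially"
  shows "(\<lambda>n. real (card {s \<in> S. snd s = \<lfloor>real (q n) * t\<rfloor> \<and> (\<forall>u\<in>L. s - nat_mul (q n) (u, 1) \<notin> S)})
    / real (q n) ^ CARD('n)) \<longlonglongrightarrow> section_volume (closure (hk_region P)) t"
proof -
  define i where "i n = \<lfloor>real (q n) * t\<rfloor>" for n
  define Q where "Q n = {m. (m, i n) \<in> S \<and> (\<forall>u\<in>L. (m, i n) - nat_mul (q n) (u, 1) \<notin> S)}" for n
  define A where "A n = {x. grid_floor (real (q n)) x \<in> Q n}" for n
  define B where "B = {x. (x, t) \<in> closure (hk_region P)}"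
  have q': "real (q n) > 0" "filterlim (\<lambda>n. real (q n)) at_top sequentially" for n
    using q filterlim_compose[OF filterlim_real_sequentially q(2)] by auto
  have inj: "inj_on (\<lambda>m. (m, i n)) X" for n and X :: "(int ^ 'n) set" by (auto simp: inj_on_def)
  have img: "(\<lambda>m. (m, i n)) ` Q n
      = {s \<in> S. snd s = i n \<and> (\<forall>u\<in>L. s - nat_mul (q n) (u, 1) \<notin> S)}" for n
    by (auto simp: Q_def)
  have finQ: "finite (Q n)" for n
  proof (rule finite_imageD[OF _ inj])
    show "finite ((\<lambda>m. (m, i n)) ` Q n)"
      unfolding img by (rule finite_subset[OF _ finite_coord_semigroup_graded[OF finite_lattice, of "i n"]]) blast
  qed
  have meas: "measure lborel (A n)
      = real (card {s \<in> S. snd s = i n \<and> (\<forall>u\<in>L. s - nat_mul (q n) (u, 1) \<notin> S)}) / real (q n) ^ CARD('n)" for n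
    unfolding A_def img[symmetric] card_image[OF inj] by (rule grid_count(2)[OF q'(1) finQ])
  have A_sets [measurable]: "A n \<in> sets lborel" for n
    using grid_count(1)[OF q'(1) finQ] unfolding A_def by (rule fmeasurableD)
  have "B = (\<lambda>x. (x, t)) -` closure (hk_region P)" by (auto simp: B_def)
  then have "closed B" by (simp add: closed_vimage continuous_intros)
  then have B_sets [measurable]: "B \<in> sets lborel" by (simp add: borel_closed)
  obtain r where r: "\<And>x. x \<in> P \<Longrightarrow> norm x \<le> r"
    using compact_imp_bounded[OF compact_P] by (auto simp: bounded_iff)
  \<comment> \<open>The lattice point labelling the cell of \<open>x\<close> rescales to norm at
    most \<open>t * r\<close>. It differs from \<open>x\<close> by at most \<open>1 / q n\<close> in
    each coordinate, hence by at most \<open>CARD('n)\<close> in norm, as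
    \<open>q n \<ge> 1\<close>.\<close>
  define R where "R = t * r + CARD('n)"
  have A_bounded: "A n \<subseteq> cball 0 R" for n
  proof
    fix x assume "x \<in> A n"
    then have "(grid_floor (real (q n)) x, i n) \<in> S" by (simp add: A_def Q_def)
    then obtain y where y: "y \<in> P" "rvec (grid_floor (real (q n)) x) = of_int (i n) *\<^sub>R y"
      using real_pt_S by (force simp: mem_C_iff real_pt_def)
    have r0: "r \<ge> 0" using r[OF y(1)] norm_ge_zero order_trans by blast
    have i: "0 \<le> i n" "of_int (i n) \<le> real (q n) * t" using t by (simp_all add: i_def)
    have "norm (rvec (grid_floor (real (q n)) x)) = of_int (i n) * norm y" using i by (simp add: y(2))
    also have "\<dots> \<le> (real (q n) * t) * r" using i r[OF y(1)] t by (intro mult_mono) auto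
    finally have 1: "norm (rvec (grid_floor (real (q n)) x)) \<le> real (q n) * (t * r)" by simp
    have "norm (real (q n) *\<^sub>R x - rvec (grid_floor (real (q n)) x))
        \<le> (\<Sum>j\<in>UNIV. \<bar>(real (q n) *\<^sub>R x - rvec (grid_floor (real (q n)) x)) $ j\<bar>)"
      by (rule norm_le_l1_cart)
    also have "\<dots> \<le> (\<Sum>j\<in>(UNIV :: 'n set). 1)"
    proof (rule sum_mono)
      fix j
      have "(real (q n) *\<^sub>R x - rvec (grid_floor (real (q n)) x)) $ j = frac (real (q n) * x $ j)"
        by (simp add: rvec_def grid_floor_def frac_def)
      then show "\<bar>(real (q n) *\<^sub>R x - rvec (grid_floor (real (q n)) x)) $ j\<bar> \<le> 1"
        using frac_lt_1[of "real (q n) * x $ j"] by simp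
    qed
    finally have "norm (real (q n) *\<^sub>R x) \<le> real (q n) * (t * r) + CARD('n)"
      using 1 norm_triangle_sub[of "real (q n) *\<^sub>R x" "rvec (grid_floor (real (q n)) x)"] by simp
    also have "\<dots> \<le> real (q n) * R" using q(1)[of n] by (simp add: R_def distrib_left)
    finally show "x \<in> cball 0 R" using q(1)[of n] by simp
  qed
  \<comment> \<open>The points where membership in \<open>C\<close> or in one of its finitely many
    translates may fail to stabilise, or where passing to the closure of \<open>hk_region P\<close>
    may change membership.\<close>
  define N where "N = {x. (x, t) \<in> frontier C} \<union> (\<Union>u\<in>L. {x. (x, t) - real_pt (u, 1) \<in> frontier C})"
  have shift: "{x. (x, t) - real_pt (u, 1) \<in> frontier C} = (+) (rvec u) ` {x. (x, t - 1) \<in> frontier C}" for u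
    by (auto simp: real_pt_def intro!: image_eqI[of _ _ "_ - rvec u"])
  have "negligible N"
    unfolding N_def shift using finite_lattice
    by (intro negligible_Un negligible_Union finite_imageI) (auto intro: negligible_translation negligible_frontier_slice)
  then have "AE x in completion lborel. x \<notin> N"
    unfolding negligible_iff_null_sets by (rule AE_not_in)
  then have AE_N: "AE x in lborel. x \<notin> N" unfolding AE_completion_iff .
  have conv: "(\<lambda>n. indicator (A n) x :: real) \<longlonglongrightarrow> indicator B x" if x: "x \<notin> N" for x
  proof -
    define s where "s n = (grid_floor (real (q n)) x, i n)" for n
    have floor: "(\<lambda>n. of_int \<lfloor>real (q n) * b\<rfloor> / real (q n)) \<longlonglongrightarrow> b" for b
      by (rule tendsto_floor_div[OF q'])
    have "(\<lambda>n. (\<chi> j. of_int \<lfloor>real (q n) * x $ j\<rfloor> / real (q n), of_int \<lfloor>real (q n) * t\<rfloor> / real (q n)))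
        \<longlonglongrightarrow> (\<chi> j. x $ j, t)"
      by (intro tendsto_Pair vec_tendstoI) (simp_all add: floor)
    moreover have "(\<chi> j. of_int \<lfloor>real (q n) * x $ j\<rfloor> / real (q n), of_int \<lfloor>real (q n) * t\<rfloor> / real (q n))
        = inverse (real (q n)) *\<^sub>R real_pt (s n)" for n
      by (simp add: s_def real_pt_def rvec_def grid_floor_def i_def vec_eq_iff divide_inverse mult.commute)
    ultimately have lim: "(\<lambda>n. inverse (real (q n)) *\<^sub>R real_pt (s n)) \<longlonglongrightarrow> (x, t)"
      by simp
    have lim_u: "(\<lambda>n. inverse (real (q n)) *\<^sub>R real_pt (s n - nat_mul (q n) (u, 1))) \<longlonglongrightarrow> (x, t) - real_pt (u, 1)" for u
    proof -
      have "inverse (real (q n)) *\<^sub>R real_pt (s n - nat_mul (q n) (u, 1))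
          = inverse (real (q n)) *\<^sub>R real_pt (s n) - real_pt (u, 1)" for n
        using q(1)[of n] by (simp add: real_pt_diff real_pt_nat_mul scaleR_diff_right)
      then show ?thesis using tendsto_diff[OF lim tendsto_const] by simp
    qed
    \<comment> \<open>Off the frontier, the limit is either interior to \<open>C\<close> or outside
      this closed cone.\<close>
    have decide: "eventually (\<lambda>n. r n \<in> S \<longleftrightarrow> z \<in> C) sequentially"
      if r: "(\<lambda>n. inverse (real (q n)) *\<^sub>R real_pt (r n)) \<longlonglongrightarrow> z" and z: "z \<notin> frontier C" for r z
    proof (cases "z \<in> C")
      case True
      then have "z \<in> interior C" using z closure_subset[of C] by (auto simp: frontier_def)
      from eventually_S[OF r this q'] show ?thesis using True by simp
    next
      case False
      from eventually_not_S[OF r this q'(1)] show ?thesis using False by simp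
    qed
    have "eventually (\<lambda>n. s n \<in> S \<longleftrightarrow> (x, t) \<in> C) sequentially"
      using x by (intro decide lim) (auto simp: N_def)
    moreover have "eventually (\<lambda>n. \<forall>u\<in>L. s n - nat_mul (q n) (u, 1) \<in> S \<longleftrightarrow> (x, t) - real_pt (u, 1) \<in> C) sequentially"
      using x by (intro eventually_ball_finite finite_lattice ballI decide lim_u) (auto simp: N_def)
    ultimately have "eventually (\<lambda>n. x \<in> A n \<longleftrightarrow> x \<in> B) sequentially"
    proof eventually_elim
      case (elim n)
      have "x \<in> A n \<longleftrightarrow> s n \<in> S \<and> (\<forall>u\<in>L. s n - nat_mul (q n) (u, 1) \<notin> S)"
        by (simp add: A_def Q_def s_def)
      also have "\<dots> \<longleftrightarrow> (x, t) \<in> hk_region P" using elim unfolding hk_region_iff by blast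
      also have "\<dots> \<longleftrightarrow> x \<in> B"
        using x closure_hk_region_iff[of "(x, t)"] by (auto simp: N_def B_def)
      finally show ?case .
    qed
    then show ?thesis
      by (intro tendsto_eventually) (auto elim!: eventually_mono simp: indicator_def)
  qed
  have "(\<lambda>n. integral\<^sup>L lborel (indicator (A n) :: _ \<Rightarrow> real)) \<longlonglongrightarrow> integral\<^sup>L lborel (indicator B)"
  proof (rule integral_dominated_convergence[where w = "indicator (cball 0 R)"])
    show "integrable lborel (indicator (cball 0 R :: (real ^ 'n) set) :: _ \<Rightarrow> real)"
      using emeasure_lborel_cball_finite by (intro integrable_real_indicator) auto
    show "AE x in lborel. (\<lambda>n. indicator (A n) x :: real) \<longlonglongrightarrow> indicator B x"
      using AE_N by eventually_elim (rule conv)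
    show "AE x in lborel. norm (indicator (A n) x :: real) \<le> indicator (cball 0 R) x" for n
      using A_bounded[of n] by (intro AE_I2) (auto simp: indicator_def)
  qed simp_all
  then show ?thesis by (simp add: meas i_def section_volume_def B_def)
qed

end

theorem theorem1p1:
  fixes \<Sigma> :: "(real ^ 'n) set set"
    and a :: "int ^ 'n \<Rightarrow> int"
    and t :: real
  assumes "CHAR('k::alg_closed_field) > 0"
    and "toric_pair TYPE('k) \<Sigma> a"
    and "t \<ge> 0"
  shows "HKd TYPE('k) \<Sigma> a t = section_volume (closure (hk_region (div_polytope \<Sigma> a))) t"
proof -
  let ?P = "div_polytope \<Sigma> a"
  have prime: "prime CHAR('k)" using assms(1) by (rule prime_CHAR_semidom)
  have base: "complete_fan \<Sigma>" "T_Cartier \<Sigma> a" "base_point_free TYPE('k) \<Sigma> a"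
    using assms(2) by (simp_all add: toric_pair_def very_ample_def)
  interpret generating_polytope ?P
  proof
    show "finite (lattice_pts ?P)" by (rule finite_lattice_pts[OF bounded_div_polytope[OF base]])
    show "lattice_pts ?P \<noteq> {}" using basepoint_section[OF base] by blast
    show "?P = convex hull (rvec ` lattice_pts ?P)" by (rule div_polytope_eq_hull[OF base])
    show "\<exists>s\<in>coord_semigroup ?P. \<exists>s'\<in>coord_semigroup ?P. (m, 0) = s - s'" for m
      using coord_semigroup_generates[OF assms(2), of m] by blast
  qed
  have "strict_mono (\<lambda>n. CHAR('k) ^ n)"
    using prime_gt_1_nat[OF prime] by (intro strict_monoI power_strict_increasing)
  then have q: "filterlim (\<lambda>n. CHAR('k) ^ n) at_top sequentially" by (rule filterlim_subseq)
  \<comment> \<open>\<open>HKd\<close> is defined through \<open>lim\<close>, so its value is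
    determined only by proving convergence; \<open>card_tendsto_section_volume\<close> gives
    convergence and value together.\<close>
  show ?thesis
    unfolding HKd_def Let_def hk_length_eq[OF prime refl finite_lattice]
    using card_tendsto_section_volume[OF assms(3) _ q] assms(1) by (intro limI) simp
qed

end
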